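(* Let $\theta$ be a real number with $1<\theta<2$. Let $\Lambda\subset\mathbb{R}^n$ be a uniformly discrete set with at least two points such that $\Lambda=\theta\Lambda+F$ for some finite set $F\subset\mathbb{R}^n$. Then $\theta$ is a Pisot number.
   Context: A set $\Lambda\subset\mathbb{R}^n$ is uniformly discrete if $\inf\{|x-y| : x,y\in\Lambda,\ x\ne y\}>0$. Notation: $\theta\Lambda=\{\theta x : x\in\Lambda\}$ and $A+B=\{a+b : a\in A,\ b\in B\}$. A Pisot number is a real algebraic integer $\theta>1$ such that all other roots $\theta'\neq\theta$ of its minimal polynomial satisfy $|\theta'|<1$. *)

theory Defs
  imports "HOL-Analysis.Analysis" "HOL-Computational_Algebra.Computational_Algebra"
begin

definition is_min_poly :: "rat poly \<Rightarrow> 'a::field_char_0 \<Rightarrow> bool" where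
  "is_min_poly p x \<longleftrightarrow>
     lead_coeff p = 1 \<and> irreducible p \<and> poly (map_poly of_rat p) x = 0"

(* "All other roots" means all other complex roots.  The polynomial p is unique, so the
   existential quantifier only names the minimal polynomial. *)
definition pisot_number :: "real \<Rightarrow> bool" where
  "pisot_number \<theta> \<longleftrightarrow>
     algebraic_int \<theta> \<and> \<theta> > 1 \<and>
     (\<exists>p. is_min_poly p \<theta> \<and>
        (\<forall>z::complex. poly (map_poly of_rat p) z = 0 \<and> z \<noteq> of_real \<theta> \<longrightarrow> norm z < 1))"

end

theory Submission
  imports Defs "HOL-Computational_Algebra.Field_as_Ring"
begin

text \<open>
  Write \<open>q\<close> for the inflation factor, put \<open>c = 1 / (q - 1)\<close> (the constant \<open>radius\<close>), and let \<open>Y\<close> be the set of values at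
  \<open>q\<close> of the polynomials with coefficients in \<open>{-1, 0, 1}\<close>.

  Iterating the inflation with two different translations \<open>a, b \<in> F\<close> realises every
  \<open>y (a - b)\<close> with \<open>y \<in> Y\<close> as a difference of two points of \<open>\<Lambda>\<close>, so uniform discreteness
  makes 0 isolated in \<open>Y\<close> (lemma \<open>inflation_gap\<close>). Isolation of 0 already forces
  \<open>Y \<inter> [-c, c]\<close> to be finite (lemma \<open>finite_bounded_values\<close>). The reason is that \<open>Y = X - X\<close>,
  where \<open>X\<close> is the set of sums of distinct powers of \<open>q\<close>: a unit window containing as many points of
  \<open>X\<close> as possible reproduces itself at every point of \<open>q\<^sup>N X\<close>, and this pins down all short
  differences of points of \<open>X\<close>. The condition \<open>q < 2\<close> enters because it makes \<open>X\<close> relatively dense.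

  Finiteness gives an algebraic integer at once: long-divide 1 in base \<open>q\<close>; two remainders coincide, and
  their difference is a monic relation. Now let \<open>z \<noteq> q\<close> be a conjugate with \<open>|z| \<ge> 1\<close>. Since conjugation
  is a well-defined map on values, \<open>p(z)\<close> stays bounded while \<open>p\<close> runs through the polynomials with
  coefficients in \<open>{-1, 0, 1}\<close> and \<open>|p(q)| \<le> c\<close>. On the other hand \<open>q < 2\<close> leaves enough freedom to
  prescribe the sign of each digit in an expansion \<open>p(q) + e\<^sub>1/q + e\<^sub>2/q\<^sup>2 + \<dots> = 0\<close>: only the alternative
  between 0 and that sign has to be left open (lemma \<open>steered_path\<close>). Choosing the signs so
  that every term \<open>e\<^sub>i/z\<^sup>i\<close> pushes in the direction given by a complex number \<open>u\<close> shows that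
  \<open>Re (u p(z)) \<le> 0\<close> whenever \<open>p(q)\<close> lies in an explicit interval depending on \<open>u\<close> (lemmas
  \<open>drift_expanding\<close> and \<open>drift_unit_circle\<close>).

  These inequalities leave no room. A positive real \<open>z\<close> would have to expand 1 by the same digits as
  \<open>q\<close> does. Otherwise take a value \<open>y \<in> Y\<close> with \<open>0 < y \<le> 1 / (q\<^sup>2 - 1)\<close> (lemma \<open>small_value\<close>). If
  \<open>z\<close> is negative, the inequalities for \<open>u = 1\<close> and \<open>u = -1\<close> make the conjugate of \<open>y\<close> vanish. If
  \<open>z\<close> is not real, the conjugates of all elements of \<open>Y \<inter> (0, c/2]\<close> lie on one ray, and since \<open>Y\<close>
  is closed under \<open>y \<mapsto> q y - 1\<close> this leaves at most one such element, whereas one constructs two. A small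
  value \<open>y\<close> exists unless \<open>q\<^sup>k = q\<^sup>k\<^sup>-\<^sup>1 + \<dots> + q + 1\<close> for some \<open>k\<close>; these numbers are Pisot by a direct
  estimate (lemma \<open>multinacci_conjugates\<close>).
\<close>

section \<open>Polynomials with coefficients in -1, 0, 1\<close>

definition ieval :: "int poly \<Rightarrow> 'a::comm_ring_1 \<Rightarrow> 'a" where
  "ieval p x = poly (map_poly of_int p) x"

lemma ieval_0 [simp]: "ieval 0 x = 0"
  by (simp add: ieval_def)

lemma ieval_pCons [simp]: "ieval (pCons a p) x = of_int a + x * ieval p x"
  by (simp add: ieval_def map_poly_pCons)

lemma ieval_add [simp]: "ieval (p + r) x = ieval p x + ieval r x"
  by (induction p r rule: poly_induct2) (simp_all add: algebra_simps)

lemma ieval_minus [simp]: "ieval (- p) x = - ieval p x"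
  by (induction p) simp_all

lemma ieval_diff [simp]: "ieval (p - r) x = ieval p x - ieval r x"
  using ieval_add[of p "- r" x] by simp

lemma ieval_1 [simp]: "ieval 1 x = 1"
  by (simp add: ieval_def)

lemma ieval_monom: "ieval (monom 1 n) x = x ^ n"
  by (simp add: ieval_def map_poly_monom poly_monom)

definition sign_polys :: "int poly set" where
  "sign_polys = {p. \<forall>i. \<bar>coeff p i\<bar> \<le> 1}"

lemma sign_polys_0: "0 \<in> sign_polys"
  by (simp add: sign_polys_def)

lemma sign_polys_pCons_iff: "pCons e p \<in> sign_polys \<longleftrightarrow> \<bar>e\<bar> \<le> 1 \<and> p \<in> sign_polys"
  unfolding sign_polys_def
proof (safe, goal_cases)
  case (1) then show ?case by (metis coeff_pCons_0)
next
  case (2 i) then show ?case by (metis coeff_pCons_Suc)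
next
  case (3 i) then show ?case by (cases i) auto
qed

lemma sign_polys_1: "1 \<in> sign_polys"
  by (simp add: one_pCons sign_polys_pCons_iff sign_polys_0)

lemma sign_polys_minus: "p \<in> sign_polys \<Longrightarrow> - p \<in> sign_polys"
  by (simp add: sign_polys_def)

section \<open>From inflation sets to a spectral gap\<close>

text \<open>
  If \<open>F\<close> were a single point, undoing the inflation would shrink differences of points of \<open>\<Lambda>\<close> by
  the factor \<open>q\<close> again and again, against uniform discreteness.
\<close>

lemma inflation_digits_nontrivial:
  fixes \<Lambda> F :: "'a::real_normed_vector set"
  assumes "1 < q" and "uniform_discrete \<Lambda>" and "\<exists>x\<in>\<Lambda>. \<exists>y\<in>\<Lambda>. x \<noteq> y"
    and inflation: "\<Lambda> = (\<lambda>x. q *\<^sub>R x) ` \<Lambda> + F"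
  obtains a b where "a \<in> F" "b \<in> F" "a \<noteq> b"
proof (rule ccontr)
  assume "\<not> thesis"
  then have unique: "f = g" if "f \<in> F" "g \<in> F" for f g
    using that \<open>\<And>b a. \<lbrakk>a \<in> F; b \<in> F; a \<noteq> b\<rbrakk> \<Longrightarrow> thesis\<close> by blast
  obtain x y where xy: "x \<in> \<Lambda>" "y \<in> \<Lambda>" "x \<noteq> y"
    using assms(3) by blast
  obtain \<delta> where "\<delta> > 0" and \<delta>: "\<And>u v. u \<in> \<Lambda> \<Longrightarrow> v \<in> \<Lambda> \<Longrightarrow> dist u v < \<delta> \<Longrightarrow> u = v"
    using \<open>uniform_discrete \<Lambda>\<close> unfolding uniform_discrete_def by blast
  have split: "\<exists>u'\<in>\<Lambda>. \<exists>f\<in>F. u = q *\<^sub>R u' + f" if "u \<in> \<Lambda>" for u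
  proof -
    have "u \<in> (\<lambda>x. q *\<^sub>R x) ` \<Lambda> + F" using that by (subst (asm) inflation)
    then show ?thesis by (auto elim!: set_plus_elim)
  qed
  have descend: "\<exists>u\<in>\<Lambda>. \<exists>v\<in>\<Lambda>. q ^ n *\<^sub>R (u - v) = x - y" for n
  proof (induction n)
    case 0
    show ?case using xy by auto
  next
    case (Suc n)
    then obtain u v where uv: "u \<in> \<Lambda>" "v \<in> \<Lambda>" "q ^ n *\<^sub>R (u - v) = x - y" by blast
    from split[OF uv(1)] obtain u' f where u': "u' \<in> \<Lambda>" "f \<in> F" "u = q *\<^sub>R u' + f"
      by blast
    from split[OF uv(2)] obtain v' g where v': "v' \<in> \<Lambda>" "g \<in> F" "v = q *\<^sub>R v' + g"
      by blast
    have "u - v = q *\<^sub>R (u' - v')"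
      using u' v' unique[of f g] by (simp add: scaleR_diff_right)
    then have "q ^ Suc n *\<^sub>R (u' - v') = x - y"
      using uv by (simp add: mult.commute)
    with u' v' show ?case by blast
  qed
  obtain n where n: "norm (x - y) / \<delta> < q ^ n"
    using real_arch_pow[OF \<open>1 < q\<close>] by blast
  obtain u v where uv: "u \<in> \<Lambda>" "v \<in> \<Lambda>" "q ^ n *\<^sub>R (u - v) = x - y"
    using descend by blast
  have "q ^ n > 0" using \<open>1 < q\<close> by simp
  have "q ^ n * dist u v = norm (x - y)"
    using uv(3) \<open>1 < q\<close> by (metis abs_of_pos \<open>q ^ n > 0\<close> dist_norm norm_scaleR)
  also have "\<dots> < q ^ n * \<delta>"
    using n \<open>\<delta> > 0\<close> by (simp add: divide_simps)
  finally have "dist u v < \<delta>"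
    using \<open>q ^ n > 0\<close> by simp
  with \<delta> uv have "u = v" by blast
  with uv(3) xy show False by simp
qed

text \<open>
  Horner's scheme \<open>y \<mapsto> q y + e\<close> on values of polynomials corresponds to one inflation step
  \<open>u \<mapsto> q u + f\<close>, \<open>v \<mapsto> q v + g\<close> on a pair of points, with \<open>f, g \<in> {a, b}\<close> chosen such that
  \<open>f - g = e (a - b)\<close>. Hence \<open>y (a - b)\<close> is always a difference of two points of \<open>\<Lambda>\<close>.
\<close>

lemma inflation_gap:
  fixes \<Lambda> F :: "'a::real_normed_vector set"
  assumes "1 < q" and "uniform_discrete \<Lambda>" and "\<exists>x\<in>\<Lambda>. \<exists>y\<in>\<Lambda>. x \<noteq> y"
    and inflation: "\<Lambda> = (\<lambda>x. q *\<^sub>R x) ` \<Lambda> + F"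
  obtains \<delta> where "\<delta> > 0" "\<And>p. p \<in> sign_polys \<Longrightarrow> ieval p q \<noteq> 0 \<Longrightarrow> \<delta> \<le> \<bar>ieval p q\<bar>"
proof -
  obtain a b where ab: "a \<in> F" "b \<in> F" "a \<noteq> b"
    using inflation_digits_nontrivial[OF assms] .
  obtain \<delta> where "\<delta> > 0" and \<delta>: "\<And>u v. u \<in> \<Lambda> \<Longrightarrow> v \<in> \<Lambda> \<Longrightarrow> dist u v < \<delta> \<Longrightarrow> u = v"
    using \<open>uniform_discrete \<Lambda>\<close> unfolding uniform_discrete_def by blast
  have inflate: "q *\<^sub>R u + f \<in> \<Lambda>" if "u \<in> \<Lambda>" "f \<in> F" for u f
    by (subst inflation) (use that in blast)
  have realise: "\<exists>u\<in>\<Lambda>. \<exists>v\<in>\<Lambda>. u - v = ieval p q *\<^sub>R (a - b)" if "p \<in> sign_polys" for p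
    using that
  proof (induction p)
    case 0
    then show ?case using assms(3) by auto
  next
    case (pCons e p)
    then obtain u v where uv: "u \<in> \<Lambda>" "v \<in> \<Lambda>" "u - v = ieval p q *\<^sub>R (a - b)"
      by (auto simp: sign_polys_pCons_iff)
    have "\<bar>e\<bar> \<le> 1" using pCons.prems by (simp add: sign_polys_pCons_iff)
    then consider "e = 0" | "e = 1" | "e = -1" by linarith
    then obtain f g where fg: "f \<in> F" "g \<in> F" "f - g = of_int e *\<^sub>R (a - b)"
      using ab by cases fastforce+
    have "(q *\<^sub>R u + f) - (q *\<^sub>R v + g) = q *\<^sub>R (u - v) + (f - g)"
      by (simp add: algebra_simps)
    also have "\<dots> = ieval (pCons e p) q *\<^sub>R (a - b)"
      unfolding uv(3) fg(3) by (simp add: scaleR_add_left)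
    finally show ?case
      using inflate uv fg by blast
  qed
  show thesis
  proof
    show "\<delta> / norm (a - b) > 0" using \<open>\<delta> > 0\<close> ab by simp
  next
    fix p assume p: "p \<in> sign_polys" "ieval p q \<noteq> 0"
    obtain u v where uv: "u \<in> \<Lambda>" "v \<in> \<Lambda>" "u - v = ieval p q *\<^sub>R (a - b)"
      using realise p by blast
    have "u \<noteq> v" using uv p ab by auto
    then have "\<delta> \<le> norm (u - v)" using \<delta> uv by (force simp: dist_norm)
    also have "\<dots> = \<bar>ieval p q\<bar> * norm (a - b)" using uv by simp
    finally show "\<delta> / norm (a - b) \<le> \<bar>ieval p q\<bar>"
      using ab by (simp add: divide_simps)
  qed
qed

section \<open>Finiteness of bounded values\<close>

locale small_base =
  fixes q :: real
  assumes q_gt_1: "1 < q" and q_lt_2: "q < 2"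
begin

definition digit_sum :: "nat set \<Rightarrow> real" where
  "digit_sum A = (\<Sum>i\<in>A. q ^ i)"

definition spectrum :: "real set" where
  "spectrum = digit_sum ` {A. finite A}"

definition finite_spectrum :: "nat \<Rightarrow> real set" where
  "finite_spectrum N = digit_sum ` Pow {..<N}"

lemma finite_finite_spectrum: "finite (finite_spectrum N)"
  by (simp add: finite_spectrum_def)

lemma finite_spectrum_subset: "finite_spectrum N \<subseteq> spectrum"
  unfolding finite_spectrum_def spectrum_def
  by (intro image_mono) (auto intro: finite_subset)

lemma finite_spectrum_mono: "M \<le> N \<Longrightarrow> finite_spectrum M \<subseteq> finite_spectrum N"
  unfolding finite_spectrum_def by (intro image_mono Pow_mono) auto

lemma finite_subset_spectrum:
  assumes "finite W" "W \<subseteq> spectrum"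
  obtains N where "W \<subseteq> finite_spectrum N"
proof -
  have "\<exists>N. W \<subseteq> finite_spectrum N" using assms
  proof (induction W rule: finite_induct)
    case empty then show ?case by simp
  next
    case (insert w W)
    then obtain N where N: "W \<subseteq> finite_spectrum N" by auto
    from insert obtain A where A: "finite A" "w = digit_sum A" by (auto simp: spectrum_def)
    obtain M where "A \<subseteq> {..<M}" using finite_nat_iff_bounded A(1) by blast
    then have "w \<in> finite_spectrum M" using A by (auto simp: finite_spectrum_def)
    with N have "insert w W \<subseteq> finite_spectrum (max M N)"
      using finite_spectrum_mono[of M "max M N"] finite_spectrum_mono[of N "max M N"] by auto
    then show ?case by blast
  qed
  with that show thesis by blast
qed

lemma shift_add_mem_spectrum:
  assumes "v \<in> spectrum" "w \<in> finite_spectrum N"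
  shows "q ^ N * v + w \<in> spectrum"
proof -
  from assms obtain A B where A: "finite A" "v = digit_sum A"
    and B: "B \<subseteq> {..<N}" "w = digit_sum B"
    by (auto simp: spectrum_def finite_spectrum_def)
  have finB: "finite B" using B(1) finite_subset by blast
  have "digit_sum ((+) N ` A \<union> B) = digit_sum ((+) N ` A) + digit_sum B"
    unfolding digit_sum_def using A B finB by (intro sum.union_disjoint) auto
  also have "digit_sum ((+) N ` A) = q ^ N * v"
    by (simp add: digit_sum_def sum.reindex A sum_distrib_left power_add)
  finally have "q ^ N * v + w = digit_sum ((+) N ` A \<union> B)" using B by simp
  then show ?thesis
    unfolding spectrum_def using A finB by (intro image_eqI[where x = "(+) N ` A \<union> B"]) auto
qed

lemma top_digit_sum: "digit_sum {..<N} = (q ^ N - 1) / (q - 1)"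
  unfolding digit_sum_def using q_gt_1 by (simp add: geometric_sum)

text \<open>
  Write \<open>X\<^sub>N\<close> for \<open>finite_spectrum N\<close>. The two halves \<open>X\<^sub>N\<close> and \<open>q\<^sup>N + X\<^sub>N\<close> of \<open>X\<^sub>N\<^sub>+\<^sub>1\<close> leave no gap longer than 1 between them, because
  \<open>q\<^sup>N - 1\<close> is at most the largest element \<open>(q\<^sup>N - 1) / (q - 1)\<close> of \<open>X\<^sub>N\<close>. This is where \<open>q \<le> 2\<close> is used.
\<close>

lemma finite_spectrum_cover:
  assumes "0 \<le> t" "t \<le> digit_sum {..<N} + 1"
  shows "\<exists>x\<in>finite_spectrum N. t - 1 \<le> x \<and> x \<le> t"
  using assms
proof (induction N arbitrary: t)
  case 0
  then show ?case by (auto simp: finite_spectrum_def digit_sum_def)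
next
  case (Suc N)
  show ?case
  proof (cases "t \<le> digit_sum {..<N} + 1")
    case True
    then show ?thesis using Suc finite_spectrum_mono[of N "Suc N"] by auto
  next
    case False
    have "q ^ N - 1 \<le> (q ^ N - 1) / (q - 1)"
      using q_gt_1 q_lt_2 one_le_power[of q N] mult_left_mono[of "q - 1" 1 "q ^ N - 1"]
      by (simp add: divide_simps)
    then have "0 \<le> t - q ^ N" using False top_digit_sum[of N] by simp
    moreover have "t - q ^ N \<le> digit_sum {..<N} + 1"
      using Suc.prems by (simp add: digit_sum_def)
    ultimately obtain A where A: "A \<subseteq> {..<N}" "t - q ^ N - 1 \<le> digit_sum A" "digit_sum A \<le> t - q ^ N"
      using Suc.IH[of "t - q ^ N"] by (auto simp: finite_spectrum_def)
    have "finite A" "N \<notin> A" using A(1) finite_subset by auto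
    then have "digit_sum (insert N A) = q ^ N + digit_sum A"
      by (simp add: digit_sum_def)
    moreover have "digit_sum (insert N A) \<in> finite_spectrum (Suc N)"
      unfolding finite_spectrum_def by (intro imageI) (use A in auto)
    ultimately show ?thesis using A
      by (intro bexI[where x = "digit_sum (insert N A)"]) auto
  qed
qed

lemma zero_mem_spectrum: "0 \<in> spectrum"
  unfolding spectrum_def by (intro image_eqI[where x = "{}"]) (auto simp: digit_sum_def)

lemma spectrum_nonneg: "x \<in> spectrum \<Longrightarrow> 0 \<le> x"
  using q_gt_1 by (auto simp: spectrum_def digit_sum_def intro!: sum_nonneg)

lemma spectrum_cover:
  assumes "0 \<le> t" shows "\<exists>x\<in>spectrum. t - 1 \<le> x \<and> x \<le> t"
proof -
  obtain N where N: "t < q ^ N" using real_arch_pow[OF q_gt_1] by blast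
  have "q ^ N - 1 \<le> (q ^ N - 1) / (q - 1)"
    using q_gt_1 q_lt_2 one_le_power[of q N] mult_left_mono[of "q - 1" 1 "q ^ N - 1"]
    by (simp add: divide_simps)
  then show ?thesis
    using finite_spectrum_cover[OF assms, of N] N finite_spectrum_subset[of N] top_digit_sum[of N]
    by force
qed

text \<open>
  The sum of the series \<open>1/q + 1/q\<^sup>2 + \<dots>\<close>. It is the critical bound for the map \<open>y \<mapsto> q y + e\<close> with
  \<open>|e| \<le> 1\<close>: orbits leaving \<open>[-radius, radius]\<close> never return.
\<close>

definition radius :: real where "radius = 1 / (q - 1)"

lemma radius_gt_1: "1 < radius"
  using q_gt_1 q_lt_2 by (simp add: radius_def)

lemma q_mult_radius: "q * radius = radius + 1"
  using q_gt_1 by (simp add: radius_def field_simps)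

text \<open>
  Some unit window \<open>[t - 1, t]\<close> contains the maximal number of points of the spectrum. For a point \<open>v\<close> of
  the spectrum and \<open>N\<close> large, the window shifted by \<open>q\<^sup>N v\<close> contains the shifted points and, by maximality, no others. If
  \<open>u\<close> and \<open>v\<close> are points of the spectrum at a distance at most \<open>R < radius\<close>, then for large \<open>N\<close> the block
  \<open>q\<^sup>N v + finite_spectrum N\<close> is long enough to meet the window at \<open>q\<^sup>N u\<close>, and the common point expresses
  \<open>q\<^sup>N (u - v)\<close> as a difference of elements of two fixed finite sets.
\<close>

lemma finite_short_differences:
  assumes "\<delta> > 0" and gap: "\<And>x y. x \<in> spectrum \<Longrightarrow> y \<in> spectrum \<Longrightarrow> x \<noteq> y \<Longrightarrow> \<delta> \<le> \<bar>x - y\<bar>"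
    and "R < radius"
  shows "finite {u - v |u v. u \<in> spectrum \<and> v \<in> spectrum \<and> 0 \<le> u - v \<and> u - v \<le> R}"
proof -
  define window where "window t = spectrum \<inter> {t - 1..t}" for t
  have window_bound: "finite (window t) \<and> card (window t) \<le> card {\<lfloor>- 1 / \<delta>\<rfloor>..0}" for t
  proof -
    let ?h = "\<lambda>x. \<lfloor>(x - t) / \<delta>\<rfloor>"
    have inj: "inj_on ?h (window t)"
    proof (rule inj_onI)
      fix x y assume xy: "x \<in> window t" "y \<in> window t" and eq: "?h x = ?h y"
      have "\<bar>(x - t) / \<delta> - (y - t) / \<delta>\<bar> < 1" using eq by linarith
      then have "\<bar>x - y\<bar> < \<delta>"
        using \<open>\<delta> > 0\<close> by (simp add: diff_divide_distrib [symmetric] divide_simps split: if_splits)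
      then show "x = y" using gap[of x y] xy by (force simp: window_def)
    qed
    \<comment> \<open>Dividing by \<open>\<delta>\<close> and rounding separates the points of a window, which bounds their number.\<close>
    have img: "?h ` window t \<subseteq> {\<lfloor>- 1 / \<delta>\<rfloor>..0}"
    proof (rule image_subsetI)
      fix x assume "x \<in> window t"
      then have "- 1 / \<delta> \<le> (x - t) / \<delta>" "(x - t) / \<delta> \<le> 0"
        using \<open>\<delta> > 0\<close> by (auto simp: window_def divide_simps)
      then show "?h x \<in> {\<lfloor>- 1 / \<delta>\<rfloor>..0}"
        using floor_mono[of "- 1 / \<delta>" "(x - t) / \<delta>"] by (auto simp: floor_le_iff simp del: minus_divide_left)
    qed
    show ?thesis
      using inj_on_finite[OF inj img] card_inj_on_le[OF inj img] by simp
  qed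
  obtain t where t: "\<And>s. card (window s) \<le> card (window t)"
  proof -
    have fin: "finite (range (\<lambda>s. card (window s)))"
      by (rule finite_subset[of _ "{..card {\<lfloor>- 1 / \<delta>\<rfloor>..0}}"]) (use window_bound in auto)
    then have "Max (range (\<lambda>s. card (window s))) \<in> range (\<lambda>s. card (window s))"
      by (intro Max_in) auto
    then obtain t where "Max (range (\<lambda>s. card (window s))) = card (window t)" by blast
    then have "card (window s) \<le> card (window t)" for s
      using fin Max_ge[of "range (\<lambda>s. card (window s))"] by (metis rangeI)
    then show thesis by (rule that)
  qed
  have "0 \<in> window 0" by (simp add: window_def zero_mem_spectrum)
  then have "card (window 0) > 0" using window_bound card_gt_0_iff by blast
  then have "window t \<noteq> {}" using t[of 0] by auto
  then have "t \<ge> 0" using spectrum_nonneg by (force simp: window_def)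
  obtain N0 where N0: "window t \<subseteq> finite_spectrum N0"
    using finite_subset_spectrum[of "window t"] window_bound by (auto simp: window_def)
  obtain N1 where N1: "(t + radius) / (radius - R) < q ^ N1"
    using real_arch_pow[OF q_gt_1] by blast
  define N where "N = max N0 N1"
  have N_window: "window t \<subseteq> finite_spectrum N"
    using N0 finite_spectrum_mono[of N0 N] by (simp add: N_def)
  have "q ^ N1 \<le> q ^ N" using q_gt_1 by (intro power_increasing) (auto simp: N_def)
  with N1 have "(t + radius) / (radius - R) < q ^ N" by linarith
  \<comment> \<open>This keeps the search below inside the range where \<open>finite_spectrum N\<close> has no long gaps.\<close>
  then have N_large: "q ^ N * R + t \<le> digit_sum {..<N} + 1"
  proof -
    have "t + radius < q ^ N * (radius - R)"
      using \<open>(t + radius) / (radius - R) < q ^ N\<close> \<open>R < radius\<close> by (simp add: pos_divide_less_eq)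
    moreover have "digit_sum {..<N} = q ^ N * radius - radius"
      by (simp add: top_digit_sum radius_def diff_divide_distrib)
    ultimately show ?thesis by (simp add: right_diff_distrib)
  qed
  \<comment> \<open>Maximality of the window at \<open>t\<close>: the copies of its points already exhaust the shifted window.\<close>
  have copy: "window (q ^ N * v + t) = (+) (q ^ N * v) ` window t" if "v \<in> spectrum" for v
  proof (rule sym, rule card_seteq)
    show "finite (window (q ^ N * v + t))" using window_bound by blast
    show "(+) (q ^ N * v) ` window t \<subseteq> window (q ^ N * v + t)"
      using shift_add_mem_spectrum[OF that] N_window by (auto simp: window_def)
    show "card (window (q ^ N * v + t)) \<le> card ((+) (q ^ N * v) ` window t)"
      using t by (simp add: card_image)
  qed
  have "{u - v |u v. u \<in> spectrum \<and> v \<in> spectrum \<and> 0 \<le> u - v \<and> u - v \<le> R}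
      \<subseteq> (\<lambda>(x, w). (x - w) / q ^ N) ` (finite_spectrum N \<times> window t)"
  proof clarify
    fix u v assume uv: "u \<in> spectrum" "v \<in> spectrum" "0 \<le> u - v" "u - v \<le> R"
    have "0 \<le> q ^ N * (u - v) + t" using uv \<open>t \<ge> 0\<close> q_gt_1 by simp
    moreover have "q ^ N * (u - v) \<le> q ^ N * R" using uv q_gt_1 by (intro mult_left_mono) auto
    ultimately obtain x where x: "x \<in> finite_spectrum N"
      "q ^ N * (u - v) + t - 1 \<le> x" "x \<le> q ^ N * (u - v) + t"
      using finite_spectrum_cover[of "q ^ N * (u - v) + t" N] N_large by auto
    then have "q ^ N * v + x \<in> window (q ^ N * u + t)"
      using shift_add_mem_spectrum[OF uv(2) x(1)] by (simp add: window_def algebra_simps)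
    then obtain w where w: "w \<in> window t" "q ^ N * v + x = q ^ N * u + w"
      using copy[OF uv(1)] by auto
    then have "u - v = (x - w) / q ^ N"
      using q_gt_1 by (simp add: field_simps)
    with x w show "u - v \<in> (\<lambda>(x, w). (x - w) / q ^ N) ` (finite_spectrum N \<times> window t)"
      by (intro image_eqI[where x = "(x, w)"]) auto
  qed
  then show ?thesis
    using finite_finite_spectrum window_bound finite_subset by fastforce
qed

text \<open>
  The argument for short differences fails at the distance \<open>radius\<close> itself. A point of the spectrum close
  to the midpoint of \<open>u\<close> and \<open>v\<close> splits \<open>u - v\<close> into two differences of size at most
  \<open>(1 + radius) / 2 < radius\<close>.
\<close>

lemma finite_differences:
  assumes "\<delta> > 0" and gap: "\<And>x y. x \<in> spectrum \<Longrightarrow> y \<in> spectrum \<Longrightarrow> x \<noteq> y \<Longrightarrow> \<delta> \<le> \<bar>x - y\<bar>"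
  shows "finite {u - v |u v. u \<in> spectrum \<and> v \<in> spectrum \<and> \<bar>u - v\<bar> \<le> radius}"
proof -
  define R where "R = (1 + radius) / 2"
  define S where "S = {u - v |u v. u \<in> spectrum \<and> v \<in> spectrum \<and> 0 \<le> u - v \<and> u - v \<le> R}"
  have "finite S"
    unfolding S_def by (rule finite_short_differences[OF assms]) (use radius_gt_1 R_def in auto)
  have short: "u - v \<in> S \<union> uminus ` S" if "u \<in> spectrum" "v \<in> spectrum" "\<bar>u - v\<bar> \<le> R" for u v
  proof (cases "0 \<le> u - v")
    case True then show ?thesis using that by (auto simp: S_def)
  next
    case False
    then have "0 \<le> v - u" "v - u \<le> R" using that by auto
    then have "v - u \<in> S" using that unfolding S_def by blast
    then show ?thesis by (metis UnI2 image_eqI minus_diff_eq)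
  qed
  let ?T = "S \<union> uminus ` S"
  have "{u - v |u v. u \<in> spectrum \<and> v \<in> spectrum \<and> \<bar>u - v\<bar> \<le> radius} \<subseteq> (\<lambda>(x, y). x + y) ` (?T \<times> ?T)"
  proof clarify
    fix u v assume uv: "u \<in> spectrum" "v \<in> spectrum" "\<bar>u - v\<bar> \<le> radius"
    obtain x where x: "x \<in> spectrum" "(u + v + 1) / 2 - 1 \<le> x" "x \<le> (u + v + 1) / 2"
      using spectrum_cover[of "(u + v + 1) / 2"] spectrum_nonneg uv by fastforce
    have "\<bar>u - x\<bar> \<le> R" "\<bar>x - v\<bar> \<le> R"
      using x(2,3) uv(3) unfolding R_def abs_le_iff by (auto simp: field_simps)
    then show "u - v \<in> (\<lambda>(x, y). x + y) ` (?T \<times> ?T)"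
      using short uv x by (intro image_eqI[where x = "(u - x, x - v)"]) auto
  qed
  then show ?thesis by (rule finite_subset) (use \<open>finite S\<close> in auto)
qed

lemma ieval_sign_poly_eq_diff:
  assumes "p \<in> sign_polys"
  shows "\<exists>u\<in>spectrum. \<exists>v\<in>spectrum. ieval p q = u - v"
  using assms
proof (induction p)
  case 0
  then show ?case using zero_mem_spectrum by auto
next
  case (pCons e p)
  then obtain u v where uv: "u \<in> spectrum" "v \<in> spectrum" "ieval p q = u - v"
    by (auto simp: sign_polys_pCons_iff)
  have digit: "0 \<in> finite_spectrum 1" "1 \<in> finite_spectrum 1"
    unfolding finite_spectrum_def
    by (rule image_eqI[where x = "{}"], auto simp: digit_sum_def)
       (rule image_eqI[where x = "{0}"], auto simp: digit_sum_def)
  have "\<bar>e\<bar> \<le> 1" using pCons.prems by (simp add: sign_polys_pCons_iff)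
  then consider "e = 0" | "e = 1" | "e = -1" by linarith
  then obtain d d' where d: "d \<in> finite_spectrum 1" "d' \<in> finite_spectrum 1" "of_int e = d - d'"
    using digit by cases fastforce+
  have "ieval (pCons e p) q = (q ^ 1 * u + d) - (q ^ 1 * v + d')"
    unfolding ieval_pCons uv(3) d(3) by (simp add: algebra_simps)
  then show ?case using shift_add_mem_spectrum uv d by blast
qed

lemma diff_eq_ieval_sign_poly:
  assumes "u \<in> spectrum" "v \<in> spectrum"
  shows "\<exists>p\<in>sign_polys. ieval p q = u - v"
proof -
  obtain A B where AB: "finite A" "finite B" "u = digit_sum A" "v = digit_sum B"
    using assms by (auto simp: spectrum_def)
  \<comment> \<open>Differences of two such polynomials have coefficients in \<open>{-1, 0, 1}\<close>.\<close>
  define pol :: "nat set \<Rightarrow> int poly" where "pol A = (\<Sum>i\<in>A. monom 1 i)" for A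
  have ev: "ieval (pol A) q = digit_sum A" if "finite A" for A
    using that by (induction A) (simp_all add: pol_def digit_sum_def, simp add: ieval_monom)
  have coeff: "coeff (pol A) i = (if i \<in> A then 1 else 0)" if "finite A" for A i
    using that by (simp add: pol_def coeff_sum)
  show ?thesis
    by (rule bexI[where x = "pol A - pol B"]) (auto simp: ev AB coeff sign_polys_def)
qed

theorem finite_bounded_values:
  assumes "\<delta> > 0" and gap: "\<And>p. p \<in> sign_polys \<Longrightarrow> ieval p q \<noteq> 0 \<Longrightarrow> \<delta> \<le> \<bar>ieval p q\<bar>"
  shows "finite {ieval p q |p. p \<in> sign_polys \<and> \<bar>ieval p q\<bar> \<le> radius}"
proof -
  have "\<delta> \<le> \<bar>x - y\<bar>" if "x \<in> spectrum" "y \<in> spectrum" "x \<noteq> y" for x y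
    using diff_eq_ieval_sign_poly[OF that(1,2)] gap that(3) by force
  from finite_differences[OF \<open>\<delta> > 0\<close> this]
  show ?thesis
  proof (rule finite_subset[rotated], safe)
    fix p assume p: "p \<in> sign_polys" "\<bar>ieval p q\<bar> \<le> radius"
    from ieval_sign_poly_eq_diff[OF p(1)] obtain u v
      where "u \<in> spectrum" "v \<in> spectrum" "ieval p q = u - v" by blast
    with p(2) show "\<exists>u v. ieval p q = u - v \<and> u \<in> spectrum \<and> v \<in> spectrum \<and> \<bar>u - v\<bar> \<le> radius"
      by auto
  qed
qed

section \<open>Steering with prescribed signs\<close>

text \<open>
  The part of the series \<open>1/q + 1/q\<^sup>2 + \<dots>\<close> that belongs to the positions after \<open>k\<close> lying in \<open>S\<close>: the
  largest amount that digits 0 and 1 at these positions can still contribute, after scaling by \<open>q\<^sup>k\<close>.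
\<close>

definition tail :: "nat set \<Rightarrow> nat \<Rightarrow> real" where
  "tail S k = (\<Sum>i. if Suc (k + i) \<in> S then (1 / q) ^ Suc i else 0)"

lemma summable_tail: "summable (\<lambda>i. if Suc (k + i) \<in> S then (1 / q) ^ Suc i else 0 :: real)"
proof (rule summable_comparison_test')
  show "summable (\<lambda>i. (1 / q) ^ Suc i)"
    using q_gt_1 by (simp add: summable_geometric summable_mult del: power_one_over)
  show "norm (if Suc (k + i) \<in> S then (1 / q) ^ Suc i else 0) \<le> (1 / q) ^ Suc i" if "i \<ge> 0" for i
    using q_gt_1 by auto
qed

lemma tail_nonneg: "0 \<le> tail S k"
  unfolding tail_def using q_gt_1 by (intro suminf_nonneg summable_tail) auto

lemma tail_step: "q * tail S k = (if Suc k \<in> S then 1 else 0) + tail S (Suc k)"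
proof -
  let ?f = "\<lambda>i. if Suc (k + i) \<in> S then (1 / q) ^ Suc i else 0 :: real"
  have "tail S (Suc k) = (\<Sum>i. q * ?f (Suc i))"
    unfolding tail_def using q_gt_1 by (intro suminf_cong) auto
  also have "\<dots> = q * (\<Sum>i. ?f (Suc i))"
    by (intro suminf_mult) (rule summable_Suc_iff[of ?f, THEN iffD2, OF summable_tail])
  also have "(\<Sum>i. ?f (Suc i)) = tail S k - ?f 0"
    unfolding tail_def by (rule suminf_split_head[OF summable_tail])
  finally show ?thesis using q_gt_1 by (simp add: right_diff_distrib)
qed

lemma tail_add_compl: "tail S k + tail (- S) k = radius"
proof -
  have "tail S k + tail (- S) k = (\<Sum>i. (1 / q) ^ Suc i)"
    unfolding tail_def suminf_add[OF summable_tail summable_tail] by (intro suminf_cong) auto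
  also have "\<dots> = (1 / q) * (\<Sum>i. (1 / q) ^ i)"
    using q_gt_1 by (subst suminf_mult [symmetric]) (auto intro: summable_geometric simp del: power_one_over)
  also have "\<dots> = radius"
    using q_gt_1 by (subst suminf_geometric) (auto simp: radius_def field_simps)
  finally show ?thesis .
qed

lemma tail_empty: "tail {} k = 0"
  by (simp add: tail_def)

lemma tail_le_radius: "tail S k \<le> radius"
  using tail_add_compl[of S k] tail_nonneg[of "- S" k] by simp

text \<open>
  Digits are allowed to be 0 or 1 at positions in \<open>S\<close> and 0 or -1 elsewhere. A remainder \<open>y\<close> can be
  cancelled by the digits after \<open>k\<close> only if \<open>- tail S k \<le> y \<le> tail (- S) k\<close>. Multiplication by \<open>q\<close> turns
  this interval into one that is longer by 1 than the interval for \<open>k + 1\<close>. The latter has length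
  \<open>radius > 1\<close>, so it and its translate by one unit overlap, and one of the two allowed digits always leads
  back into it.
\<close>

lemma steered_path:
  assumes "p \<in> sign_polys" "- tail S 0 \<le> ieval p q" "ieval p q \<le> tail (- S) 0"
  obtains P e where "P 0 = p" "\<And>k. P (Suc k) = pCons (e k) (P k)" "\<And>k. P k \<in> sign_polys"
    "\<And>k. \<bar>ieval (P k) q\<bar> \<le> radius"
    "\<And>k. Suc k \<in> S \<Longrightarrow> e k \<in> {0, 1}" "\<And>k. Suc k \<notin> S \<Longrightarrow> e k \<in> {-1, 0}"
proof -
  \<comment> \<open>The last conjunct of \<open>Good\<close> fixes the starting point of the path.\<close>
  define Good where "Good k r \<longleftrightarrow> r \<in> sign_polys \<and> - tail S k \<le> ieval r q \<and> ieval r q \<le> tail (- S) k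
      \<and> (k = 0 \<longrightarrow> r = p)" for k r
  define Step where "Step k r r' \<longleftrightarrow> (\<exists>e. r' = pCons e r \<and> (if Suc k \<in> S then e \<in> {0, 1} else e \<in> {-1, 0}))"
    for k :: nat and r r' :: "int poly"
  have "\<exists>P. \<forall>k. Good k (P k) \<and> Step k (P k) (P (Suc k))"
  proof (rule dependent_nat_choice)
    show "\<exists>r. Good 0 r" using assms by (auto simp: Good_def)
  next
    fix r k assume r: "Good k r"
    define y where "y = q * ieval r q"
    have y: "- (q * tail S k) \<le> y" "y \<le> q * tail (- S) k"
      using r q_gt_1 mult_left_mono[of "- tail S k" "ieval r q" q] unfolding y_def Good_def by auto
    have total: "tail S (Suc k) + tail (- S) (Suc k) > 1"
      using tail_add_compl radius_gt_1 by simp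
    show "\<exists>r'. Good (Suc k) r' \<and> Step k r r'"
    proof (cases "Suc k \<in> S")
      case True
      define e :: int where "e = (if - tail S (Suc k) \<le> y then 0 else 1)"
      have "Good (Suc k) (pCons e r)" "Step k r (pCons e r)"
        using r True y total tail_step[of S k] tail_step[of "- S" k]
        by (auto simp: Good_def Step_def e_def sign_polys_pCons_iff y_def)
      then show ?thesis by blast
    next
      case False
      define e :: int where "e = (if y \<le> tail (- S) (Suc k) then 0 else -1)"
      have "Good (Suc k) (pCons e r)" "Step k r (pCons e r)"
        using r False y total tail_step[of S k] tail_step[of "- S" k]
        by (auto simp: Good_def Step_def e_def sign_polys_pCons_iff y_def)
      then show ?thesis by blast
    qed
  qed
  then obtain P where good: "\<And>k. Good k (P k)" and step: "\<And>k. Step k (P k) (P (Suc k))" by blast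
  from step have "\<forall>k. \<exists>e. P (Suc k) = pCons e (P k) \<and> (if Suc k \<in> S then e \<in> {0, 1} else e \<in> {-1, 0})"
    unfolding Step_def by blast
  then obtain e where e: "\<And>k. P (Suc k) = pCons (e k) (P k)"
    "\<And>k. if Suc k \<in> S then e k \<in> {0, 1} else e k \<in> {-1, 0}"
    by metis
  show thesis
  proof (rule that[of P e])
    show "P 0 = p" "P k \<in> sign_polys" for k using good[of 0] good[of k] by (auto simp: Good_def)
    show "\<bar>ieval (P k) q\<bar> \<le> radius" for k
      using good[of k] tail_le_radius[of S k] tail_le_radius[of "- S" k] by (auto simp: Good_def)
    show "P (Suc k) = pCons (e k) (P k)" for k by (rule e)
    show "Suc k \<in> S \<Longrightarrow> e k \<in> {0, 1}" "Suc k \<notin> S \<Longrightarrow> e k \<in> {-1, 0}" for k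
      using e(2)[of k] by simp_all
  qed
qed

text \<open>
  For the even positions the tail is periodic with period 2, so the recursion determines it.
\<close>

lemma tail_even: "tail {i. even i} 0 = 1 / (q\<^sup>2 - 1)" "1 / (q\<^sup>2 - 1) \<le> tail {i. odd i} 0"
proof -
  have q2: "1 < q\<^sup>2" using q_gt_1 by (simp add: one_less_power)
  have period: "tail {i. even i} (Suc (Suc 0)) = tail {i. even i} 0"
    unfolding tail_def by simp
  have odd: "tail {i. even i} (Suc 0) = tail {i. odd i} 0"
    unfolding tail_def by simp
  have "q * tail {i. even i} 0 = tail {i. odd i} 0"
    using tail_step[of "{i. even i}" 0] odd by simp
  moreover have "q * tail {i. odd i} 0 = 1 + tail {i. even i} 0"
    using tail_step[of "{i. even i}" "Suc 0"] odd period by simp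
  ultimately have "q\<^sup>2 * tail {i. even i} 0 = 1 + tail {i. even i} 0"
    by (simp add: power2_eq_square mult.assoc)
  then show even: "tail {i. even i} 0 = 1 / (q\<^sup>2 - 1)"
    using q2 by (simp add: field_simps)
  have "1 * tail {i. even i} 0 \<le> q * tail {i. even i} 0"
    using q_gt_1 tail_nonneg by (intro mult_right_mono) auto
  then show "1 / (q\<^sup>2 - 1) \<le> tail {i. odd i} 0"
    using even \<open>q * tail {i. even i} 0 = tail {i. odd i} 0\<close> by simp
qed

end

section \<open>Algebraic integrality of the base\<close>

locale discrete_base = small_base +
  fixes \<delta> :: real
  assumes gap_pos: "0 < \<delta>"
    and gap: "\<And>p. p \<in> sign_polys \<Longrightarrow> ieval p q \<noteq> 0 \<Longrightarrow> \<delta> \<le> \<bar>ieval p q\<bar>"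
begin

text \<open>
  Follow a path of digits in \<open>{-1, 0}\<close> from the polynomial 1. The \<open>k\<close>-th polynomial is monic of degree \<open>k\<close>,
  and all values at \<open>q\<close> lie in one finite set, so two of them agree.
\<close>

theorem algebraic_integer_base: "algebraic_int q"
proof -
  have "- tail {} 0 \<le> ieval 1 q" "ieval 1 q \<le> tail (- {}) 0"
    using tail_add_compl[of "{}" 0] radius_gt_1 by (simp_all add: tail_empty)
  from steered_path[OF sign_polys_1 this] obtain P e where
    P: "P 0 = 1" "\<And>k. P (Suc k) = pCons (e k) (P k)" "\<And>k. P k \<in> sign_polys"
      "\<And>k. \<bar>ieval (P k) q\<bar> \<le> radius"
    by metis
  have monic: "lead_coeff (P k) = 1 \<and> degree (P k) = k" for k
  proof (induction k)
    case 0 show ?case by (simp add: P)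
  next
    case (Suc k)
    then have "degree (P k) = k" "coeff (P k) k = 1" by metis+
    moreover from this have "P k \<noteq> 0" by auto
    ultimately show ?case by (simp add: P(2))
  qed
  have "range (\<lambda>k. ieval (P k) q) \<subseteq> {ieval p q |p. p \<in> sign_polys \<and> \<bar>ieval p q\<bar> \<le> radius}"
    using P by blast
  then have "finite (range (\<lambda>k. ieval (P k) q))"
    using finite_bounded_values[OF gap_pos gap] finite_subset by blast
  then have "\<not> inj (\<lambda>k. ieval (P k) q)" using finite_imageD infinite_UNIV_nat by blast
  then obtain k l where kl: "k < l" "ieval (P k) q = ieval (P l) q"
    unfolding inj_def by (metis nat_neq_iff)
  have "degree (P l - P k) = l" "lead_coeff (P l - P k) = 1"
  proof -
    have "degree (P k) < degree (P l)" using monic kl by simp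
    then have "degree (P l - P k) = degree (P l)"
      by (metis degree_add_eq_left degree_minus diff_conv_add_uminus)
    then show "degree (P l - P k) = l" using monic by simp
    moreover have "coeff (P l) l = 1" using monic[of l] by metis
    moreover have "coeff (P k) l = 0" using monic[of k] kl(1) by (simp add: coeff_eq_0)
    ultimately show "lead_coeff (P l - P k) = 1" by simp
  qed
  then show ?thesis
    unfolding algebraic_int_altdef_ipoly using kl
    by (intro exI[where x = "P l - P k"]) (simp add: ieval_def [symmetric])
qed

end

section \<open>Drift at a conjugate outside the open unit disc\<close>

text \<open>
  The assumption says that \<open>q\<close> and \<open>z\<close> have the same minimal polynomial, in the only form in which it is
  used: \<open>g(q) \<mapsto> g(z)\<close> is a well-defined injective map.
\<close>

locale conjugate_base = discrete_base +
  fixes z :: complex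
  assumes conjugate: "ieval g q = 0 \<longleftrightarrow> ieval g z = 0"
    and norm_ge_1: "1 \<le> cmod z"
begin

lemma z_nonzero: "z \<noteq> 0"
  using norm_ge_1 by auto

lemma conjugate_eq_iff: "ieval g q = ieval h q \<longleftrightarrow> ieval g z = ieval h z"
  using conjugate[of "g - h"] by simp

text \<open>
  An equation satisfied by \<open>z\<close> passes to \<open>q\<close>, and \<open>q\<^sup>n > 1\<close>.
\<close>

lemma power_neq_1:
  assumes "0 < n" shows "z ^ n \<noteq> 1"
proof
  assume "z ^ n = 1"
  then have "ieval (monom 1 n - 1) z = 0"
    by (simp add: ieval_monom)
  then have "ieval (monom 1 n - 1) q = 0" using conjugate by blast
  then have "q ^ n = 1"
    by (simp add: ieval_monom)
  with one_less_power[OF q_gt_1 assms] show False by simp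
qed

lemma conjugate_values_bounded:
  obtains C where "\<And>p. p \<in> sign_polys \<Longrightarrow> \<bar>ieval p q\<bar> \<le> radius \<Longrightarrow> cmod (ieval p z) \<le> C"
proof -
  define B where "B = {p. p \<in> sign_polys \<and> \<bar>ieval p q\<bar> \<le> radius}"
  have "finite ((\<lambda>p. ieval p q) ` B)"
    using finite_bounded_values[OF gap_pos gap]
    by (rule rev_finite_subset) (auto simp: B_def)
  moreover have "(\<lambda>p. ieval p z) ` B
      \<subseteq> (\<lambda>y. ieval (SOME p. p \<in> B \<and> ieval p q = y) z) ` ((\<lambda>p. ieval p q) ` B)"
  proof (rule image_subsetI)
    fix p assume p: "p \<in> B"
    let ?r = "SOME r. r \<in> B \<and> ieval r q = ieval p q"
    have "?r \<in> B \<and> ieval ?r q = ieval p q"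
      by (rule someI[of _ p]) (use p in simp)
    then have "ieval p z = ieval ?r z" using conjugate_eq_iff by metis
    then show "ieval p z \<in> (\<lambda>y. ieval (SOME p. p \<in> B \<and> ieval p q = y) z) ` ((\<lambda>p. ieval p q) ` B)"
      using p by blast
  qed
  ultimately have "finite ((\<lambda>p. ieval p z) ` B)" by (meson finite_imageI finite_subset)
  then have "bounded ((\<lambda>p. ieval p z) ` B)" by (rule finite_imp_bounded)
  then obtain C where "\<And>p. p \<in> B \<Longrightarrow> cmod (ieval p z) \<le> C"
    unfolding bounded_iff by blast
  then show thesis by (intro that[of C]) (auto simp: B_def)
qed

text \<open>
  The linear functional \<open>Re (u p(z)) - c p(q)\<close>, rescaled along a path, grows with each digit when \<open>S\<close>
  records the signs of \<open>Re (u / z\<^sup>i) - c / q\<^sup>i\<close>, and it tends to 0 since the values at \<open>z\<close> are bounded and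
  \<open>|z| > 1\<close>. Hence it starts at a value \<open>\<le> 0\<close>. The parameter \<open>c\<close> serves for positive real conjugates,
  where the signs of \<open>Re (u / z\<^sup>i)\<close> alone do not vary.
\<close>

lemma drift_expanding:
  assumes "1 < cmod z" and p: "p \<in> sign_polys" "- tail S 0 \<le> ieval p q" "ieval p q \<le> tail (- S) 0"
    and pos: "\<And>i. 0 < i \<Longrightarrow> i \<in> S \<Longrightarrow> c / q ^ i \<le> Re (u / z ^ i)"
    and neg: "\<And>i. 0 < i \<Longrightarrow> i \<notin> S \<Longrightarrow> Re (u / z ^ i) \<le> c / q ^ i"
  shows "Re (u * ieval p z) \<le> c * ieval p q"
proof -
  obtain P e where P: "P 0 = p" "\<And>k. P (Suc k) = pCons (e k) (P k)" "\<And>k. P k \<in> sign_polys"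
    "\<And>k. \<bar>ieval (P k) q\<bar> \<le> radius"
    and e: "\<And>k. Suc k \<in> S \<Longrightarrow> e k \<in> {0, 1}" "\<And>k. Suc k \<notin> S \<Longrightarrow> e k \<in> {-1, 0}"
    using steered_path[OF p] by metis
  obtain C where C: "\<And>p. p \<in> sign_polys \<Longrightarrow> \<bar>ieval p q\<bar> \<le> radius \<Longrightarrow> cmod (ieval p z) \<le> C"
    using conjugate_values_bounded by blast
  define W where "W k = Re (u * ieval (P k) z / z ^ k) - c * ieval (P k) q / q ^ k" for k
  have W_step: "W (Suc k) = W k + of_int (e k) * (Re (u / z ^ Suc k) - c / q ^ Suc k)" for k
  proof -
    have "u * ieval (P (Suc k)) z / z ^ Suc k
        = u * ieval (P k) z / z ^ k + of_int (e k) *\<^sub>R (u / z ^ Suc k)"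
      using z_nonzero by (simp add: P(2) scaleR_conv_of_real field_simps)
    moreover have "c * ieval (P (Suc k)) q / q ^ Suc k
        = c * ieval (P k) q / q ^ k + of_int (e k) * (c / q ^ Suc k)"
      using q_gt_1 by (simp add: P(2) field_simps)
    ultimately show ?thesis
      unfolding W_def by (simp only: plus_complex.sel scaleR_complex.sel right_diff_distrib)
  qed
  have "incseq W"
  proof (rule incseq_SucI)
    fix k
    have "0 \<le> of_int (e k) * (Re (u / z ^ Suc k) - c / q ^ Suc k)"
    proof (cases "Suc k \<in> S")
      case True
      then show ?thesis using e(1)[OF True] pos[of "Suc k"] by (intro mult_nonneg_nonneg) auto
    next
      case False
      then show ?thesis using e(2)[OF False] neg[of "Suc k"] by (intro mult_nonpos_nonpos) auto
    qed
    then show "W k \<le> W (Suc k)" using W_step by simp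
  qed
  moreover have "W \<longlonglongrightarrow> 0"
  proof (rule Lim_null_comparison)
    show "\<forall>\<^sub>F k in sequentially. norm (W k) \<le> cmod u * C * (1 / cmod z) ^ k + \<bar>c\<bar> * radius * (1 / q) ^ k"
    proof (intro always_eventually allI)
      fix k
      have "\<bar>Re (u * ieval (P k) z / z ^ k)\<bar> \<le> cmod (u * ieval (P k) z / z ^ k)"
        by (rule abs_Re_le_cmod)
      also have "\<dots> = cmod u * cmod (ieval (P k) z) * (1 / cmod z) ^ k"
        by (simp add: norm_mult norm_divide norm_power norm_inverse power_inverse divide_inverse)
      also have "\<dots> \<le> cmod u * C * (1 / cmod z) ^ k"
        using C P by (intro mult_right_mono mult_left_mono) auto
      finally have 1: "\<bar>Re (u * ieval (P k) z / z ^ k)\<bar> \<le> cmod u * C * (1 / cmod z) ^ k" .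
      have "\<bar>c * ieval (P k) q / q ^ k\<bar> = \<bar>c\<bar> * \<bar>ieval (P k) q\<bar> * (1 / q) ^ k"
        using q_gt_1 by (simp add: abs_mult power_inverse divide_inverse)
      also have "\<dots> \<le> \<bar>c\<bar> * radius * (1 / q) ^ k"
        using P q_gt_1 by (intro mult_right_mono mult_left_mono) auto
      finally have 2: "\<bar>c * ieval (P k) q / q ^ k\<bar> \<le> \<bar>c\<bar> * radius * (1 / q) ^ k" .
      show "norm (W k) \<le> cmod u * C * (1 / cmod z) ^ k + \<bar>c\<bar> * radius * (1 / q) ^ k"
        unfolding W_def real_norm_def using 1 2 by linarith
    qed
    have "(\<lambda>k. (1 / t) ^ k) \<longlonglongrightarrow> 0" if "1 < t" for t :: real
      using that by (intro LIMSEQ_realpow_zero) (auto simp: divide_simps)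
    from tendsto_add[OF tendsto_mult_right_zero[OF this[OF \<open>1 < cmod z\<close>]]
        tendsto_mult_right_zero[OF this[OF q_gt_1]]]
    show "(\<lambda>k. cmod u * C * (1 / cmod z) ^ k + \<bar>c\<bar> * radius * (1 / q) ^ k) \<longlonglongrightarrow> 0"
      by simp
  qed
  ultimately have "W 0 \<le> 0" by (rule incseq_le)
  then show ?thesis by (simp add: W_def P)
qed

text \<open>
  On the unit circle the rescaled functional is bounded but need not tend to 0. Either the path reaches 0,
  and then the functional ends at 0; or it runs for ever and has nonzero digits with bounded gaps. In
  the second case the increments \<open>|Re (u / z\<^sup>k)|\<close> at these positions tend to 0, so that the numbers \<open>u / z\<^sup>k\<close>
  approach the imaginary axis. Two such positions at bounded distance \<open>j\<close> then force \<open>z\<^sup>j\<close> to be almost real,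
  which is impossible as no positive power of \<open>z\<close> is real.
\<close>

lemma drift_unit_circle:
  assumes "cmod z = 1" and p: "p \<in> sign_polys" "- tail S 0 \<le> ieval p q" "ieval p q \<le> tail (- S) 0"
    and pos: "\<And>i. 0 < i \<Longrightarrow> i \<in> S \<Longrightarrow> 0 \<le> Re (u / z ^ i)"
    and neg: "\<And>i. 0 < i \<Longrightarrow> i \<notin> S \<Longrightarrow> Re (u / z ^ i) \<le> 0"
  shows "Re (u * ieval p z) \<le> 0"
proof (rule ccontr)
  assume contra: "\<not> Re (u * ieval p z) \<le> 0"
  then have "u \<noteq> 0" by auto
  obtain P e where P: "P 0 = p" "\<And>k. P (Suc k) = pCons (e k) (P k)" "\<And>k. P k \<in> sign_polys"
    "\<And>k. \<bar>ieval (P k) q\<bar> \<le> radius"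
    and e: "\<And>k. Suc k \<in> S \<Longrightarrow> e k \<in> {0, 1}" "\<And>k. Suc k \<notin> S \<Longrightarrow> e k \<in> {-1, 0}"
    using steered_path[OF p] by metis
  obtain C where C: "\<And>p. p \<in> sign_polys \<Longrightarrow> \<bar>ieval p q\<bar> \<le> radius \<Longrightarrow> cmod (ieval p z) \<le> C"
    using conjugate_values_bounded by blast
  define W where "W k = Re (u * ieval (P k) z / z ^ k)" for k
  have W_step: "W (Suc k) = W k + of_int (e k) * Re (u / z ^ Suc k)" for k
  proof -
    have "u * ieval (P (Suc k)) z / z ^ Suc k
        = u * ieval (P k) z / z ^ k + of_int (e k) *\<^sub>R (u / z ^ Suc k)"
      using z_nonzero by (simp add: P(2) scaleR_conv_of_real field_simps)
    then show ?thesis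
      unfolding W_def by (simp only: plus_complex.sel scaleR_complex.sel)
  qed
  \<comment> \<open>A nonzero digit has the sign of \<open>Re (u / z ^ Suc k)\<close>.\<close>
  have gain: "of_int (e k) * Re (u / z ^ Suc k) = (if e k = 0 then 0 else \<bar>Re (u / z ^ Suc k)\<bar>)" for k
  proof (cases "Suc k \<in> S")
    case True
    then show ?thesis using e(1)[OF True] pos[of "Suc k"] by auto
  next
    case False
    then show ?thesis using e(2)[OF False] neg[of "Suc k"] by auto
  qed
  have "incseq W"
    by (rule incseq_SucI) (simp add: W_step gain del: power_Suc)
  have "W 0 > 0" using contra by (simp add: W_def P)
  then have W_pos: "W k > 0" for k using \<open>incseq W\<close> by (metis incseqD le0 less_le_trans)
  have nonzero: "ieval (P k) q \<noteq> 0" for k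
    using W_pos[of k] conjugate[of "P k"] by (auto simp: W_def)
  have "\<bar>W k\<bar> \<le> cmod u * C" for k
  proof -
    have "\<bar>W k\<bar> \<le> cmod (u * ieval (P k) z / z ^ k)" unfolding W_def by (rule abs_Re_le_cmod)
    also have "\<dots> = cmod u * cmod (ieval (P k) z)"
      using \<open>cmod z = 1\<close> by (simp add: norm_mult norm_divide norm_power)
    also have "\<dots> \<le> cmod u * C" using C P by (intro mult_left_mono) auto
    finally show ?thesis .
  qed
  then have "W k \<le> cmod u * C" for k by (simp add: abs_le_iff)
  then obtain L where "W \<longlonglongrightarrow> L" using incseq_convergent[OF \<open>incseq W\<close>] by metis
  then have "(\<lambda>k. W (Suc k) - W k) \<longlonglongrightarrow> L - L" by (intro tendsto_diff LIMSEQ_Suc)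
  then have gain_null: "(\<lambda>k. of_int (e k) * Re (u / z ^ Suc k)) \<longlonglongrightarrow> 0"
    by (simp add: W_step del: power_Suc)
  obtain J where J: "radius / \<delta> < q ^ J"
    using real_arch_pow[OF q_gt_1] by blast
  \<comment> \<open>A run of \<open>J\<close> zero digits would multiply a remainder of size at least \<open>\<delta>\<close> by \<open>q ^ J\<close>.\<close>
  have recur: "\<exists>j<J. e (k + j) \<noteq> 0" for k
  proof (rule ccontr)
    assume "\<not> (\<exists>j<J. e (k + j) \<noteq> 0)"
    then have "j \<le> J \<Longrightarrow> ieval (P (k + j)) q = q ^ j * ieval (P k) q" for j
      by (induction j) (auto simp: P(2))
    then have "\<bar>ieval (P (k + J)) q\<bar> = q ^ J * \<bar>ieval (P k) q\<bar>"
      using q_gt_1 by (simp add: abs_mult)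
    moreover have "q ^ J * \<delta> \<le> q ^ J * \<bar>ieval (P k) q\<bar>"
      using gap[OF P(3) nonzero] q_gt_1 by (intro mult_left_mono) auto
    moreover have "radius < q ^ J * \<delta>" using J gap_pos by (simp add: pos_divide_less_eq)
    ultimately show False using P(4)[of "k + J"] by linarith
  qed
  have Im_power: "Im (z ^ j) \<noteq> 0" if "0 < j" for j
  proof
    assume "Im (z ^ j) = 0"
    then have "z ^ j = of_real (Re (z ^ j))" by (simp add: complex_eq_iff)
    moreover have "cmod (z ^ j) = 1" using \<open>cmod z = 1\<close> by (simp add: norm_power)
    ultimately have "\<bar>Re (z ^ j)\<bar> = 1" by (metis norm_of_real)
    then have "(Re (z ^ j))\<^sup>2 = 1" by (metis power2_abs one_power2)
    then have "(z ^ j)\<^sup>2 = 1" using \<open>z ^ j = of_real (Re (z ^ j))\<close> by (metis of_real_1 of_real_power)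
    then show False using power_neq_1[of "j * 2"] that by (simp add: power_mult)
  qed
  define \<kappa> where "\<kappa> = Min ((\<lambda>j. \<bar>Im (z ^ j)\<bar>) ` {1..Suc J})"
  have \<kappa>_le: "\<kappa> \<le> \<bar>Im (z ^ j)\<bar>" if "1 \<le> j" "j \<le> Suc J" for j
    unfolding \<kappa>_def using that by (intro Min_le) auto
  have "\<kappa> > 0" unfolding \<kappa>_def using Im_power by (subst Min_gr_iff) auto
  have "\<kappa> \<le> 1" using \<kappa>_le[of 1] abs_Im_le_cmod[of z] \<open>cmod z = 1\<close> by simp
  \<comment> \<open>Small enough that \<open>|Im v| \<ge> |u| - \<eta>\<close> and \<open>|Im v| |Im Z| < 2 \<eta>\<close> below contradict \<open>|Im Z| \<ge> \<kappa>\<close>.\<close>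
  define \<eta> where "\<eta> = cmod u * \<kappa> / 4"
  have "\<eta> > 0" using \<open>u \<noteq> 0\<close> \<open>\<kappa> > 0\<close> by (simp add: \<eta>_def)
  from LIMSEQ_D[OF gain_null this] obtain k0
    where k0: "\<And>k. k \<ge> k0 \<Longrightarrow> norm (of_int (e k) * Re (u / z ^ Suc k) - 0) < \<eta>" by blast
  have small: "\<bar>Re (u / z ^ Suc k)\<bar> < \<eta>" if "k \<ge> k0" "e k \<noteq> 0" for k
    using k0[OF that(1)] that(2) by (simp only: gain) simp
  obtain j1 where "e (k0 + j1) \<noteq> 0" using recur by blast
  define k1 where "k1 = k0 + j1"
  obtain j2 where j2: "j2 < J" "e (Suc k1 + j2) \<noteq> 0" using recur by blast
  define v where "v = u / z ^ Suc k1"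
  define Z where "Z = z ^ Suc j2"
  have "\<bar>Re v\<bar> < \<eta>" unfolding v_def using small[of k1] \<open>e (k0 + j1) \<noteq> 0\<close> by (simp add: k1_def)
  have "cmod Z = 1" using \<open>cmod z = 1\<close> by (simp add: Z_def norm_power norm_mult)
  then have "Z * cnj Z = 1" by (metis complex_norm_square of_real_1 one_power2)
  then have "inverse Z = cnj Z" by (rule inverse_unique)
  have "u / z ^ Suc (Suc k1 + j2) = v / Z"
    by (simp add: v_def Z_def power_add)
  also have "\<dots> = v * cnj Z" using \<open>inverse Z = cnj Z\<close> by (simp add: divide_inverse)
  finally have "Re (u / z ^ Suc (Suc k1 + j2)) = Re v * Re Z + Im v * Im Z" by simp
  moreover have "\<bar>Re (u / z ^ Suc (Suc k1 + j2))\<bar> < \<eta>"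
    using small[of "Suc k1 + j2"] j2(2) by (simp add: k1_def)
  ultimately have "\<bar>Im v * Im Z\<bar> < \<eta> + \<bar>Re v * Re Z\<bar>" by linarith
  moreover have "\<bar>Re v * Re Z\<bar> \<le> \<bar>Re v\<bar>"
    using abs_Re_le_cmod[of Z] \<open>cmod Z = 1\<close> by (simp add: abs_mult mult_left_le)
  ultimately have upper: "\<bar>Im v\<bar> * \<bar>Im Z\<bar> < 2 * \<eta>"
    using \<open>\<bar>Re v\<bar> < \<eta>\<close> by (simp add: abs_mult)
  have "cmod v = cmod u" using \<open>cmod z = 1\<close> by (simp add: v_def norm_divide norm_power norm_mult)
  then have "cmod u - \<eta> \<le> \<bar>Im v\<bar>"
    using cmod_le[of v] \<open>\<bar>Re v\<bar> < \<eta>\<close> by linarith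
  moreover have "\<eta> \<le> cmod u / 4" using \<open>\<kappa> \<le> 1\<close> by (simp add: \<eta>_def mult_left_le)
  ultimately have "cmod u * 3 / 4 \<le> \<bar>Im v\<bar>" by linarith
  moreover have "\<kappa> \<le> \<bar>Im Z\<bar>" unfolding Z_def using \<kappa>_le[of "Suc j2"] j2 by simp
  ultimately have "(cmod u * 3 / 4) * \<kappa> \<le> \<bar>Im v\<bar> * \<bar>Im Z\<bar>"
    using \<open>\<kappa> > 0\<close> by (intro mult_mono) auto
  with upper have "(cmod u * 3 / 4) * \<kappa> < 2 * (cmod u * \<kappa> / 4)"
    unfolding \<eta>_def by linarith
  moreover have "cmod u * \<kappa> > 0" using \<open>u \<noteq> 0\<close> \<open>\<kappa> > 0\<close> by simp
  ultimately show False by linarith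
qed

end

section \<open>Multinacci polynomials\<close>

text \<open>
  The polynomials \<open>x\<^sup>k - x\<^sup>k\<^sup>-\<^sup>1 - \<dots> - x - 1\<close>.
\<close>

fun multinacci :: "nat \<Rightarrow> int poly" where
  "multinacci 0 = 1"
| "multinacci (Suc k) = pCons (-1) (multinacci k)"

lemma multinacci_sign_poly: "multinacci k \<in> sign_polys"
  by (induction k) (simp_all add: sign_polys_1 sign_polys_pCons_iff)

lemma multinacci_closed_form: "(x - 1) * ieval (multinacci k) x = x ^ k * (x - 2) + 1"
proof (induction k)
  case (Suc k)
  have "(x - 1) * ieval (multinacci (Suc k)) x = x * ((x - 1) * ieval (multinacci k) x) - (x - 1)"
    by (simp add: algebra_simps)
  then show ?case unfolding Suc by (simp add: algebra_simps)
qed simp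

text \<open>
  Divided by \<open>x\<^sup>k\<close>, the polynomial becomes \<open>1 - 1/x - \<dots> - 1/x\<^sup>k\<close>, which increases with \<open>x\<close>.
\<close>

lemma multinacci_less:
  fixes s t :: real
  assumes "0 < s" "s < t" "0 \<le> ieval (multinacci k) s" "0 < k"
  shows "ieval (multinacci k) s < ieval (multinacci k) t"
  using assms(3,4)
proof (induction k)
  case (Suc k)
  then have "0 < s * ieval (multinacci k) s" by simp
  then have pos: "0 < ieval (multinacci k) s" using \<open>0 < s\<close> by (simp add: zero_less_mult_iff)
  have "ieval (multinacci k) s \<le> ieval (multinacci k) t"
    using Suc.IH pos by (cases "k = 0") auto
  then have "s * ieval (multinacci k) s < t * ieval (multinacci k) t"
    using pos assms by (intro mult_less_le_imp_less) auto
  then show ?case by simp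
qed simp

lemma norm_power_minus_multinacci:
  fixes z :: complex
  shows "cmod (z ^ k - ieval (multinacci k) z) \<le> cmod z ^ k - ieval (multinacci k) (cmod z)"
proof (induction k)
  case (Suc k)
  have "z ^ Suc k - ieval (multinacci (Suc k)) z = z * (z ^ k - ieval (multinacci k) z) + 1"
    by (simp add: algebra_simps)
  also have "cmod \<dots> \<le> cmod z * cmod (z ^ k - ieval (multinacci k) z) + 1"
    using norm_triangle_ineq[of "z * (z ^ k - ieval (multinacci k) z)" 1] by (simp add: norm_mult)
  also have "\<dots> \<le> cmod z * (cmod z ^ k - ieval (multinacci k) (cmod z)) + 1"
    using Suc by (intro add_right_mono mult_left_mono) auto
  finally show ?case by (simp add: algebra_simps)
qed simp

text \<open>
  By the closed form a root satisfies \<open>z\<^sup>k (2 - z) = 1\<close>. For \<open>1 < r < q\<close> one has \<open>r\<^sup>k (2 - r) > 1\<close>, which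
  contradicts \<open>|2 - z| \<ge> 2 - |z|\<close> if \<open>|z| = r\<close>; and \<open>|z| > q\<close> is impossible because \<open>z\<^sup>k\<close> cannot then be the sum of
  the lower powers. For \<open>|z| \<in> {1, q}\<close> the triangle inequality is an equality, so \<open>z\<close> is
  positive, and 1 is not a root.
\<close>

lemma multinacci_conjugates:
  fixes q :: real and z :: complex
  assumes "1 < q" "q < 2" and root: "ieval (multinacci k) q = 0" "ieval (multinacci k) z = 0"
    and "1 \<le> cmod z"
  shows "z = of_real q"
proof -
  define r where "r = cmod z"
  have "k \<noteq> 0" using root by (intro notI) simp
  have "cmod (z ^ k) \<le> r ^ k - ieval (multinacci k) r"
    using norm_power_minus_multinacci[of z k] root(2) by (simp add: r_def)
  then have "ieval (multinacci k) r \<le> 0" by (simp add: norm_power r_def)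
  then have "r \<le> q"
    using multinacci_less[of q r k] assms \<open>k \<noteq> 0\<close> by force
  have "z ^ k * (2 - z) = 1"
    using multinacci_closed_form[of z k] root(2) by (simp add: algebra_simps)
  then have "cmod (z ^ k * (2 - z)) = 1" by simp
  then have modulus: "r ^ k * cmod (2 - z) = 1" by (simp add: norm_mult norm_power r_def)
  have triangle: "2 - r \<le> cmod (2 - z)"
    using norm_triangle_ineq2[of 2 z] by (simp add: r_def)
  have "\<not> (1 < r \<and> r < q)"
  proof
    assume r: "1 < r \<and> r < q"
    then have "ieval (multinacci k) r < 0"
      using multinacci_less[of r q k] root(1) \<open>k \<noteq> 0\<close> by force
    then have "(r - 1) * ieval (multinacci k) r < 0" using r by (simp add: mult_pos_neg)
    then have "1 < r ^ k * (2 - r)"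
      using multinacci_closed_form[of r k] by (simp add: algebra_simps)
    also have "\<dots> \<le> r ^ k * cmod (2 - z)"
      using triangle r by (intro mult_left_mono) auto
    finally show False using modulus by simp
  qed
  then have "r = 1 \<or> r = q" using \<open>r \<le> q\<close> \<open>1 \<le> cmod z\<close> by (auto simp: r_def)
  moreover have "q ^ k * (2 - q) = 1"
    using multinacci_closed_form[of q k] root(1) by (simp add: algebra_simps)
  ultimately have "r ^ k * (2 - r) = 1" by auto
  moreover have "r ^ k > 0" using \<open>1 \<le> cmod z\<close> unfolding r_def by (intro zero_less_power) linarith
  ultimately have "cmod (2 - z) = 2 - r"
    using modulus by (metis mult_left_cancel less_irrefl)
  then have "(cmod (2 - z))\<^sup>2 = (2 - r)\<^sup>2" by simp
  then have "(2 - Re z)\<^sup>2 + (Im z)\<^sup>2 = 4 - 4 * r + r\<^sup>2"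
    by (simp add: cmod_power2) (simp add: power2_eq_square algebra_simps)
  moreover have "r\<^sup>2 = (Re z)\<^sup>2 + (Im z)\<^sup>2" by (simp add: r_def cmod_power2)
  ultimately have "Re z = r" by (simp add: power2_eq_square algebra_simps)
  then have "Im z = 0" using \<open>r\<^sup>2 = (Re z)\<^sup>2 + (Im z)\<^sup>2\<close> by simp
  with \<open>Re z = r\<close> have z: "z = of_real r" by (simp add: complex_eq_iff)
  have "ieval (multinacci j) (1::complex) = 1 - of_nat j" for j
    by (induction j) auto
  with root(2) z have "r = 1 \<Longrightarrow> k = 1" by simp
  moreover have "k = 1 \<Longrightarrow> q = 1" using root(1) by simp
  ultimately show ?thesis using \<open>r = 1 \<or> r = q\<close> z \<open>1 < q\<close> by auto
qed

context small_base
begin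

text \<open>
  The multinacci polynomials take at \<open>q\<close> the values of the orbit of 1 under \<open>y \<mapsto> q y - 1\<close>, which
  decreases to \<open>-\<infinity>\<close>. The first term that is at most \<open>a = 1 / (q\<^sup>2 - 1)\<close> is still at least \<open>-a\<close>, since
  \<open>q a - 1 > -a\<close>; it or its negative is the required value, as it is not 0.
\<close>

lemma small_value:
  assumes nonzero: "\<And>k. ieval (multinacci k) q \<noteq> 0"
  obtains p where "p \<in> sign_polys" "0 < ieval p q" "ieval p q \<le> 1 / (q\<^sup>2 - 1)"
proof -
  define a where "a = 1 / (q\<^sup>2 - 1)"
  have q2: "1 < q\<^sup>2" using q_gt_1 by (simp add: one_less_power)
  have a: "0 < a" "q * a + a = radius"
    using q2 q_gt_1 by (simp_all add: a_def radius_def field_simps power2_eq_square)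
  have val: "ieval (multinacci k) q = radius - (radius - 1) * q ^ k" for k
  proof (induction k)
    case (Suc k)
    have "ieval (multinacci (Suc k)) q = (q * radius - 1) - (radius - 1) * q ^ Suc k"
      by (simp add: Suc right_diff_distrib left_diff_distrib mult.left_commute)
    then show ?case by (simp add: q_mult_radius)
  qed simp
  obtain n where n: "radius / (radius - 1) < q ^ n" using real_arch_pow[OF q_gt_1] by blast
  then have "ieval (multinacci n) q < 0"
    using radius_gt_1 by (simp add: val pos_divide_less_eq mult.commute)
  then have "ieval (multinacci n) q \<le> a" using a by simp
  define k where "k = (LEAST k. ieval (multinacci k) q \<le> a)"
  have k: "ieval (multinacci k) q \<le> a"
    unfolding k_def by (rule LeastI) (rule \<open>ieval (multinacci n) q \<le> a\<close>)
  have "- a \<le> ieval (multinacci k) q"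
  proof (cases k)
    case 0
    then show ?thesis using a by simp
  next
    case (Suc j)
    then have "a < ieval (multinacci j) q"
      using not_less_Least[of j "\<lambda>k. ieval (multinacci k) q \<le> a"] unfolding k_def by fastforce
    then have "q * a < q * ieval (multinacci j) q" using q_gt_1 by simp
    then show ?thesis using a radius_gt_1 by (simp add: Suc)
  qed
  show thesis
  proof (cases "0 < ieval (multinacci k) q")
    case True
    then show thesis using that[OF multinacci_sign_poly] k by (simp add: a_def)
  next
    case False
    then show thesis
      using that[OF sign_polys_minus[OF multinacci_sign_poly[of k]]] nonzero[of k]
        \<open>- a \<le> ieval (multinacci k) q\<close> by (simp add: a_def)
  qed
qed

end

section \<open>Excluding the conjugates outside the open unit disc\<close>

context conjugate_base
begin

text \<open>
  An expansion \<open>1 = d\<^sub>1/q + d\<^sub>2/q\<^sup>2 + \<dots>\<close> with digits 0 and 1 would also hold with \<open>t\<close> in place of \<open>q\<close>,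
  but its right-hand side depends strictly monotonically on the base. In terms of the drift, the slope
  \<open>\<plusminus> q/t\<close> makes the signs negative at all positions.
\<close>

lemma real_positive_conjugate:
  assumes "z = of_real t" "0 < t" shows "t = q"
proof (rule ccontr)
  assume "t \<noteq> q"
  have "t \<noteq> 1" using power_neq_1[of 1] assms by auto
  then have "1 < t" using norm_ge_1 assms by simp
  have one: "- tail {} 0 \<le> ieval 1 q" "ieval 1 q \<le> tail (- {}) 0"
    using tail_add_compl[of "{}" 0] radius_gt_1 by (simp_all add: tail_empty)
  have Re_power: "Re (of_real x / z ^ i) = x / t ^ i" for x i
    by (simp add: assms flip: of_real_power of_real_divide)
  show False
  proof (cases "t < q")
    case True
    have "Re ((-1) * ieval 1 z) \<le> - (q / t) * ieval 1 q"
    proof (rule drift_expanding[OF _ sign_polys_1 one])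
      fix i :: nat assume "0 < i"
      have "q / t \<le> (q / t) ^ i"
        using True \<open>1 < t\<close> \<open>0 < i\<close> by (intro self_le_power) auto
      then have "- 1 / t ^ i \<le> - (q / t) / q ^ i"
        using q_gt_1 \<open>1 < t\<close> by (simp add: field_simps power_divide)
      then show "Re (- 1 / z ^ i) \<le> - (q / t) / q ^ i" using Re_power[of "-1" i] by simp
    qed (use \<open>1 < t\<close> assms in auto)
    then show False using True \<open>1 < t\<close> by (simp add: field_simps)
  next
    case False
    then have "q < t" using \<open>t \<noteq> q\<close> by simp
    have "Re (1 * ieval 1 z) \<le> (q / t) * ieval 1 q"
    proof (rule drift_expanding[OF _ sign_polys_1 one])
      fix i :: nat assume "0 < i"
      have "(q / t) ^ i \<le> (q / t) ^ 1"
        using \<open>q < t\<close> q_gt_1 \<open>0 < i\<close> by (intro power_decreasing) auto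
      then have "1 / t ^ i \<le> (q / t) / q ^ i"
        using q_gt_1 \<open>1 < t\<close> by (simp add: field_simps power_divide)
      then show "Re (1 / z ^ i) \<le> (q / t) / q ^ i" using Re_power[of 1 i] by simp
    qed (use \<open>1 < t\<close> assms in auto)
    then show False using \<open>q < t\<close> q_gt_1 by (simp add: field_simps)
  qed
qed

text \<open>
  The signs of \<open>1 / t\<^sup>i\<close> alternate. The bound \<open>1 / (q\<^sup>2 - 1)\<close> is the smaller of the two tails over the even and
  the odd positions, so the drift estimate applies both with \<open>u = 1\<close> and with \<open>u = -1\<close>.
\<close>

lemma no_real_negative_conjugate:
  assumes p: "p \<in> sign_polys" "0 < ieval p q" "ieval p q \<le> 1 / (q\<^sup>2 - 1)"
    and "z = of_real t" "t < 0"
  shows False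
proof -
  have "t \<noteq> -1" using power_neq_1[of 2] assms by auto
  then have "1 < \<bar>t\<bar>" using norm_ge_1 assms by simp
  have compl: "- {i::nat. even i} = {i. odd i}" "- {i::nat. odd i} = {i. even i}" by auto
  have Re_power: "Re (of_real x / z ^ i) = x / t ^ i" for x i
    by (simp add: assms flip: of_real_power of_real_divide)
  have "Re (1 * ieval p z) \<le> 0 * ieval p q"
  proof (rule drift_expanding[where S = "{i. even i}"])
    show "0 / q ^ i \<le> Re (1 / z ^ i)" if "i \<in> {i. even i}" for i
      using that Re_power[of 1 i] by (simp add: zero_le_even_power)
    show "Re (1 / z ^ i) \<le> 0 / q ^ i" if "i \<notin> {i. even i}" for i
      using that Re_power[of 1 i] \<open>t < 0\<close> by (simp add: divide_le_0_iff power_le_zero_eq odd_pos)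
  qed (use p tail_even compl tail_nonneg[of "{i. even i}" 0] \<open>1 < \<bar>t\<bar>\<close> assms in auto)
  moreover have "Re (- 1 * ieval p z) \<le> 0 * ieval p q"
  proof (rule drift_expanding[where S = "{i. odd i}"])
    show "0 / q ^ i \<le> Re (- 1 / z ^ i)" if "i \<in> {i. odd i}" for i
      using that Re_power[of "-1" i] \<open>t < 0\<close> by (simp add: divide_le_0_iff power_le_zero_eq odd_pos)
    show "Re (- 1 / z ^ i) \<le> 0 / q ^ i" if "i \<notin> {i. odd i}" for i
      using that Re_power[of "-1" i] by (simp add: zero_le_even_power)
  qed (use p tail_even compl tail_nonneg[of "{i. odd i}" 0] \<open>1 < \<bar>t\<bar>\<close> assms in auto)
  ultimately have "Re (ieval p z) = 0" by simp
  moreover have "ieval p z = of_real (ieval p t)"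
    unfolding assms(4) by (induction p) simp_all
  ultimately have "ieval p z = 0" by simp
  then show False using conjugate[of p] p by simp
qed

lemma drift_nonreal:
  assumes "Im z \<noteq> 0" "p \<in> sign_polys" "- tail {i. 0 \<le> Re (u / z ^ i)} 0 \<le> ieval p q"
    "ieval p q \<le> tail (- {i. 0 \<le> Re (u / z ^ i)}) 0"
  shows "Re (u * ieval p z) \<le> 0"
proof (cases "cmod z = 1")
  case True
  then show ?thesis by (rule drift_unit_circle[OF _ assms(2-4)]) auto
next
  case False
  then have "1 < cmod z" using norm_ge_1 by simp
  then have "Re (u * ieval p z) \<le> 0 * ieval p q"
    by (rule drift_expanding[OF _ assms(2-4)]) auto
  then show ?thesis by simp
qed

text \<open>
  The two tails for a set of signs add up to \<open>radius\<close>, so one of them is at least \<open>radius / 2\<close>. Which one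
  depends on \<open>u\<close> only, and it decides the sign of \<open>Re (u p(z))\<close> for all values in \<open>(0, radius / 2]\<close> together.
\<close>

lemma same_half_plane:
  assumes "Im z \<noteq> 0"
    and p: "p \<in> sign_polys" "0 < ieval p q" "ieval p q \<le> radius / 2"
    and r: "r \<in> sign_polys" "0 < ieval r q" "ieval r q \<le> radius / 2"
  shows "0 \<le> Re (u * ieval p z) * Re (u * ieval r z)"
proof -
  define S where "S = {i. 0 \<le> Re (u / z ^ i)}"
  have drift: "Re (u * ieval g z) \<le> 0"
    if "g \<in> sign_polys" "- tail S 0 \<le> ieval g q" "ieval g q \<le> tail (- S) 0" for g
    using drift_nonreal[OF \<open>Im z \<noteq> 0\<close> that[unfolded S_def]] .
  consider "radius / 2 \<le> tail (- S) 0" | "radius / 2 \<le> tail S 0"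
    using tail_add_compl[of S 0] by linarith
  then show ?thesis
  proof cases
    case 1
    then have "Re (u * ieval p z) \<le> 0" "Re (u * ieval r z) \<le> 0"
      using p r tail_nonneg[of S 0] drift[of p] drift[of r] by linarith+
    then show ?thesis by (rule mult_nonpos_nonpos)
  next
    case 2
    then have "Re (u * ieval (- p) z) \<le> 0" "Re (u * ieval (- r) z) \<le> 0"
      using p r tail_nonneg[of "- S" 0] drift[of "- p"] drift[of "- r"] sign_polys_minus
        ieval_minus[of p q] ieval_minus[of r q]
      by force+
    then show ?thesis
      unfolding ieval_minus mult_minus_right uminus_complex.sel by (intro mult_nonneg_nonneg) linarith+
  qed
qed

text \<open>
  Two nonzero complex numbers that no line through 0 separates strictly are positive multiples of
  each other.
\<close>

lemma same_ray:
  assumes "Im z \<noteq> 0"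
    and p: "p \<in> sign_polys" "0 < ieval p q" "ieval p q \<le> radius / 2"
    and r: "r \<in> sign_polys" "0 < ieval r q" "ieval r q \<le> radius / 2"
  shows "\<exists>t>0. ieval r z = of_real t * ieval p z"
proof -
  have "ieval p z \<noteq> 0" "ieval r z \<noteq> 0" using conjugate p r by force+
  define w where "w = ieval r z / ieval p z"
  have half: "0 \<le> Re v * Re (v * w)" for v
    using same_half_plane[OF assms, of "v / ieval p z"] \<open>ieval p z \<noteq> 0\<close> by (simp add: w_def)
  have "Im w = 0"
  proof (rule ccontr)
    assume "Im w \<noteq> 0"
    \<comment> \<open>With \<open>v = 1 + \<i> s\<close> the product \<open>Re v * Re (v * w)\<close> is \<open>Re w - s * Im w = -1\<close>.\<close>
    define s where "s = (Re w + 1) / Im w"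
    have "0 \<le> Re w - s * Im w" using half[of "Complex 1 s"] by simp
    then show False using \<open>Im w \<noteq> 0\<close> by (simp add: s_def)
  qed
  then have w: "w = of_real (Re w)" by (simp add: complex_eq_iff)
  have "0 \<le> Re w" using half[of 1] by simp
  moreover have "w \<noteq> 0" using \<open>ieval p z \<noteq> 0\<close> \<open>ieval r z \<noteq> 0\<close> by (simp add: w_def)
  ultimately have "0 < Re w" using w by (metis less_eq_real_def of_real_0)
  moreover have "ieval r z = w * ieval p z" using \<open>ieval p z \<noteq> 0\<close> by (simp add: w_def)
  ultimately show ?thesis using w by metis
qed

text \<open>
  If \<open>q y \<le> radius / 2\<close>, then \<open>y\<close> and \<open>q y\<close> would have conjugates on the same ray, although the quotient of
  the conjugates is \<open>z\<close>, which is not real.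
\<close>

lemma nonreal_successor:
  assumes "Im z \<noteq> 0" and p: "p \<in> sign_polys" "0 < ieval p q" "ieval p q \<le> radius / 2"
  shows "radius / 2 < q * ieval p q" and "\<bar>q * ieval p q - 1\<bar> \<le> radius / 2"
proof -
  have "ieval p z \<noteq> 0" using conjugate p by force
  show large: "radius / 2 < q * ieval p q"
  proof (rule ccontr)
    assume "\<not> ?thesis"
    then have "\<exists>t>0. ieval (pCons 0 p) z = of_real t * ieval p z"
      using p q_gt_1 by (intro same_ray assms) (auto simp: sign_polys_pCons_iff)
    then have "z \<in> \<real>" using \<open>ieval p z \<noteq> 0\<close> by auto
    with \<open>Im z \<noteq> 0\<close> show False by (simp add: complex_is_Real_iff)
  qed
  have "q * ieval p q \<le> q * (radius / 2)" using p q_gt_1 by (intro mult_left_mono) auto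
  then show "\<bar>q * ieval p q - 1\<bar> \<le> radius / 2"
    using large q_mult_radius radius_gt_1 by linarith
qed

text \<open>
  As \<open>q y - 1\<close> or its negative lies again in \<open>[0, radius / 2]\<close>, its conjugate is a real multiple of that
  of \<open>y\<close>. The conclusion says that the reciprocal of the conjugate of \<open>y\<close> has imaginary part \<open>Im z\<close>.
\<close>

lemma nonreal_reciprocal_height:
  assumes "Im z \<noteq> 0" and p: "p \<in> sign_polys" "0 < ieval p q" "ieval p q \<le> radius / 2"
  shows "\<exists>t::real. (z - of_real t) * ieval p z = 1"
proof -
  let ?y = "q * ieval p q - 1"
  have bound: "\<bar>?y\<bar> \<le> radius / 2" by (rule nonreal_successor(2)[OF assms])
  have mem: "pCons (-1) p \<in> sign_polys" using p by (simp add: sign_polys_pCons_iff)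
  have "\<exists>t::real. z * ieval p z - 1 = of_real t * ieval p z"
  proof (cases "?y = 0")
    case True
    then have "ieval (pCons (-1) p) z = 0" using conjugate[of "pCons (-1) p"] by simp
    then show ?thesis by (intro exI[of _ 0]) simp
  next
    case False
    show ?thesis
    proof (cases "0 < ?y")
      case True
      then have "\<exists>t>0. ieval (pCons (-1) p) z = of_real t * ieval p z"
        using bound mem by (intro same_ray assms) auto
      then show ?thesis by auto
    next
      case neg: False
      then have "\<exists>t>0. ieval (- pCons (-1) p) z = of_real t * ieval p z"
        using bound mem False by (intro same_ray assms sign_polys_minus) (auto simp del: minus_pCons)
      then obtain t where "ieval (- pCons (-1) p) z = of_real t * ieval p z" by blast
      then have "z * ieval p z - 1 = of_real (- t) * ieval p z"
        by (simp del: minus_pCons add: algebra_simps)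
      then show ?thesis by blast
    qed
  qed
  then obtain t :: real where "z * ieval p z - 1 = of_real t * ieval p z" by blast
  then show ?thesis by (intro exI[of _ t]) (simp add: algebra_simps)
qed

text \<open>
  The conjugates of the two values lie on one ray and their reciprocals have the same nonzero imaginary
  part.
\<close>

lemma nonreal_unique_value:
  assumes "Im z \<noteq> 0"
    and p: "p \<in> sign_polys" "0 < ieval p q" "ieval p q \<le> radius / 2"
    and r: "r \<in> sign_polys" "0 < ieval r q" "ieval r q \<le> radius / 2"
  shows "ieval p q = ieval r q"
proof -
  obtain \<tau> where \<tau>: "0 < \<tau>" "ieval r z = of_real \<tau> * ieval p z"
    using same_ray[OF assms] by blast
  obtain t s :: real where ts: "(z - of_real t) * ieval p z = 1" "(z - of_real s) * ieval r z = 1"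
    using nonreal_reciprocal_height[OF assms(1-4)] nonreal_reciprocal_height[OF assms(1) r] by blast
  then have "(z - of_real t) * ieval p z = ((z - of_real s) * of_real \<tau>) * ieval p z"
    by (simp add: \<tau>(2) mult.assoc)
  moreover have "ieval p z \<noteq> 0" using ts(1) by auto
  ultimately have "z - of_real t = (z - of_real s) * of_real \<tau>" by simp
  then have "Im (z - of_real t) = Im ((z - of_real s) * of_real \<tau>)" by simp
  then have "Im z = Im z * \<tau>" by simp
  then have "\<tau> = 1" using \<open>Im z \<noteq> 0\<close> by simp
  then show ?thesis using \<tau>(2) conjugate_eq_iff[of p r] by simp
qed

text \<open>
  The value \<open>y\<close> is the only one in \<open>(0, radius / 2]\<close>, so \<open>q y - 1 \<in> {0, y, -y}\<close>. If \<open>y = 1 / q\<close>, then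
  \<open>q - 1\<close> is a second value, unless \<open>q\<close> is the golden ratio; if \<open>y = 1 / (q + 1)\<close>, then
  \<open>|q\<^sup>2 y - 1| = |q\<^sup>2 - q - 1| y\<close> is a smaller one; and \<open>q y - 1 = y\<close> would give \<open>y = radius\<close>.
\<close>

lemma no_nonreal_conjugate:
  assumes "Im z \<noteq> 0" and p: "p \<in> sign_polys" "0 < ieval p q" "ieval p q \<le> 1 / (q\<^sup>2 - 1)"
    and not_golden: "q\<^sup>2 - q - 1 \<noteq> 0"
  shows False
proof -
  define y where "y = ieval p q"
  have q2: "1 < q\<^sup>2" using q_gt_1 by (simp add: one_less_power)
  have "1 / (q\<^sup>2 - 1) = radius / (q + 1)"
    by (simp add: radius_def power2_eq_square algebra_simps)
  also have "\<dots> \<le> radius / 2"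
    using q_gt_1 radius_gt_1 by (intro divide_left_mono) auto
  finally have small: "ieval p q \<le> radius / 2" using p by simp
  note unique = nonreal_unique_value[OF \<open>Im z \<noteq> 0\<close> p(1,2) small, folded y_def]
  have succ: "\<bar>q * y - 1\<bar> \<le> radius / 2"
    unfolding y_def by (rule nonreal_successor(2)[OF \<open>Im z \<noteq> 0\<close> p(1,2) small])
  have mem: "pCons (-1) p \<in> sign_polys" using p by (simp add: sign_polys_pCons_iff)
  consider "q * y - 1 = 0" | "0 < q * y - 1" | "q * y - 1 < 0" by linarith
  then show False
  proof cases
    case 1
    then have y: "y = 1 / q" using q_gt_1 by (simp add: field_simps)
    have "1 / q \<le> 1 / (q\<^sup>2 - 1)" using p(3) y by (simp add: y_def)
    then have "q\<^sup>2 - 1 \<le> q" using q2 q_gt_1 by (simp add: divide_simps split: if_splits)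
    then have "q - 1 \<le> 1 / q" using q_gt_1 by (simp add: field_simps power2_eq_square)
    also have "\<dots> \<le> radius / 2" using small y by (simp add: y_def)
    finally have "y = ieval [:-1, 1:] q"
      using q_gt_1 by (intro unique) (auto simp: sign_polys_pCons_iff sign_polys_0)
    then have "1 / q = q - 1" using y by simp
    then have "q\<^sup>2 - q - 1 = 0" using q_gt_1 by (simp add: field_simps power2_eq_square)
    with not_golden show False ..
  next
    case 2
    then have "y = ieval (pCons (-1) p) q"
      using succ mem by (intro unique) (auto simp: y_def)
    then have "y = radius" using q_gt_1 by (simp add: y_def radius_def field_simps)
    then show False using small radius_gt_1 by (simp add: y_def)
  next
    case 3
    then have "y = ieval (- pCons (-1) p) q"
      using succ mem by (intro unique sign_polys_minus) (auto simp: y_def simp del: minus_pCons)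
    then have y: "y * (q + 1) = 1" by (simp add: y_def algebra_simps)
    define x where "x = q * (q * y) - 1"
    have "x = (q\<^sup>2 - q - 1) * y"
      using y by (simp add: x_def power2_eq_square algebra_simps)
    moreover have "\<bar>q\<^sup>2 - q - 1\<bar> < 1"
    proof -
      have "0 < q * (q - 1)" "0 < (2 - q) * (1 + q)" using q_gt_1 q_lt_2 by simp_all
      then show ?thesis by (simp add: abs_less_iff power2_eq_square algebra_simps)
    qed
    ultimately have x: "\<bar>x\<bar> < y" "x \<noteq> 0"
      using not_golden p(2) by (auto simp: abs_mult y_def mult_less_cancel_right2)
    have mem2: "pCons (-1) (pCons 0 p) \<in> sign_polys" using p by (simp add: sign_polys_pCons_iff)
    have "ieval (pCons (-1) (pCons 0 p)) q = x" by (simp add: x_def y_def)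
    then have "y = x \<or> y = - x"
      using unique[OF mem2] unique[OF sign_polys_minus[OF mem2]] x small
      by (cases "0 < x") (auto simp: y_def simp del: minus_pCons)
    with x show False by auto
  qed
qed

theorem no_other_large_conjugate: "z = of_real q"
proof (cases "\<exists>k. ieval (multinacci k) q = 0")
  case True
  then show ?thesis
    using multinacci_conjugates[OF q_gt_1 q_lt_2] conjugate norm_ge_1 by blast
next
  case False
  then obtain p where p: "p \<in> sign_polys" "0 < ieval p q" "ieval p q \<le> 1 / (q\<^sup>2 - 1)"
    using small_value by blast
  have "ieval (multinacci (Suc (Suc 0))) q \<noteq> 0" using False by blast
  then have "q\<^sup>2 - q - 1 \<noteq> 0" by (simp add: power2_eq_square algebra_simps)
  then have "Im z = 0" using no_nonreal_conjugate p by blast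
  then have z: "z = of_real (Re z)" by (simp add: complex_eq_iff)
  have "Re z \<noteq> 0" using z z_nonzero by auto
  moreover have "\<not> Re z < 0" using no_real_negative_conjugate[OF p z] by blast
  ultimately have "0 < Re z" by simp
  from real_positive_conjugate[OF z this] z show ?thesis by simp
qed

end

section \<open>Minimal polynomials over the rationals\<close>

lemma ieval_eq_rat_poly:
  "ieval g x = poly (map_poly of_rat (map_poly of_int g)) (x :: 'a::field_char_0)"
  by (induction g) (simp_all add: map_poly_pCons)

lemma rat_poly_mult:
  "poly (map_poly of_rat (f * g)) x = poly (map_poly of_rat f) x * poly (map_poly of_rat g) (x :: 'a::field_char_0)"
proof (induction f)
  case (pCons a f)
  have add: "poly (map_poly of_rat (f + g)) x = poly (map_poly of_rat f) x + poly (map_poly of_rat g) x" for f g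
    by (induction f g rule: poly_induct2) (simp_all add: map_poly_pCons of_rat_add algebra_simps)
  have smult: "poly (map_poly of_rat (smult a g)) x = of_rat a * poly (map_poly of_rat g) x" for a g
    by (induction g) (simp_all add: map_poly_pCons of_rat_mult algebra_simps)
  show ?case using pCons by (simp add: add smult map_poly_pCons algebra_simps)
qed simp

lemma rat_poly_add:
  "poly (map_poly of_rat (f + g)) x = poly (map_poly of_rat f) x + poly (map_poly of_rat g) (x :: 'a::field_char_0)"
  by (induction f g rule: poly_induct2) (simp_all add: map_poly_pCons of_rat_add algebra_simps)

text \<open>
  Otherwise a Bezout identity \<open>a p + b f = 1\<close> could be evaluated at the common root.
\<close>

lemma irreducible_dvd_of_common_root:
  fixes p f :: "rat poly" and x :: "'a::field_char_0"
  assumes "irreducible p" "poly (map_poly of_rat p) x = 0" "poly (map_poly of_rat f) x = 0"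
  shows "p dvd f"
proof (rule ccontr)
  assume "\<not> p dvd f"
  then have "coprime p f"
    using prime_elem_imp_coprime[OF field_poly_irreducible_imp_prime[OF assms(1)]] by blast
  then obtain a b where "a * p + b * f = 1"
    using bezout_coefficients_fst_snd[of p f] by (metis coprime_imp_gcd_eq_1)
  then have "poly (map_poly of_rat (a * p + b * f)) x = (1::'a)" by simp
  then show False using assms by (simp add: rat_poly_add rat_poly_mult)
qed

lemma min_poly_exists:
  fixes x :: "'a::field_char_0"
  assumes "algebraic_int x"
  obtains p where "is_min_poly p x"
proof -
  obtain g :: "int poly" where g: "ieval g x = 0" "lead_coeff g = 1"
    using assms unfolding algebraic_int_altdef_ipoly ieval_def by blast
  define Vanish where "Vanish f \<longleftrightarrow> f \<noteq> 0 \<and> poly (map_poly of_rat f) x = 0" for f :: "rat poly"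
  have "coeff (map_poly of_int g :: rat poly) (degree g) = 1" using g(2) by (simp add: coeff_map_poly)
  then have "map_poly of_int g \<noteq> (0 :: rat poly)" by auto
  then have "Vanish (map_poly of_int g)" using g(1) by (simp add: Vanish_def ieval_eq_rat_poly)
  then obtain f where f: "Vanish f" "\<And>h. Vanish h \<Longrightarrow> degree f \<le> degree h"
    using ex_has_least_nat[of Vanish _ degree] by blast
  have "irreducible f"
  proof (rule irreducibleI)
    show "f \<noteq> 0" using f by (simp add: Vanish_def)
    show "\<not> f dvd 1"
    proof
      assume "f dvd 1"
      then obtain h where "f * h = 1" by (metis dvdE)
      then have "poly (map_poly of_rat (f * h)) x = (1::'a)" by simp
      with f show False by (simp add: rat_poly_mult Vanish_def)
    qed
    fix a b assume ab: "f = a * b"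
    then have nz: "a \<noteq> 0" "b \<noteq> 0" using f by (auto simp: Vanish_def)
    then have deg: "degree f = degree a + degree b" using ab by (simp add: degree_mult_eq)
    have "Vanish a \<or> Vanish b" using f(1) ab nz by (auto simp: Vanish_def rat_poly_mult)
    then have "degree b = 0 \<or> degree a = 0" using f(2)[of a] f(2)[of b] deg by linarith
    then show "a dvd 1 \<or> b dvd 1" using nz by (auto simp: is_unit_iff_degree)
  qed
  define p where "p = smult (inverse (lead_coeff f)) f"
  have "f \<noteq> 0" using f by (simp add: Vanish_def)
  have "is_min_poly p x"
    unfolding is_min_poly_def
  proof (intro conjI)
    show "lead_coeff p = 1" using \<open>f \<noteq> 0\<close> by (simp add: p_def)
    have p_eq: "p = [:inverse (lead_coeff f):] * f" by (simp add: p_def)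
    then show "irreducible p"
      using \<open>irreducible f\<close> \<open>f \<noteq> 0\<close> irreducible_mult_unit_left[of "[:inverse (lead_coeff f):]" f]
      by (simp add: is_unit_const_poly_iff dvd_field_iff del: mult_pCons_left)
    from p_eq show "poly (map_poly of_rat p) x = 0" using f(1) by (simp only: rat_poly_mult Vanish_def) simp
  qed
  then show thesis by (rule that)
qed

lemma min_poly_conjugate:
  assumes "is_min_poly p (q :: real)" "poly (map_poly of_rat p) (z :: complex) = 0"
  shows "ieval g q = 0 \<longleftrightarrow> ieval g z = 0"
proof -
  have irr: "irreducible p" and root: "poly (map_poly of_rat p) q = 0"
    using assms(1) by (simp_all add: is_min_poly_def)
  have "ieval g x = 0 \<longleftrightarrow> p dvd map_poly of_int g"
    if "poly (map_poly of_rat p) x = 0" for x :: "'a::field_char_0"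
    using irreducible_dvd_of_common_root[OF irr that, of "map_poly of_int g"] that
    by (auto simp: ieval_eq_rat_poly rat_poly_mult elim!: dvdE)
  from this[OF root] this[OF assms(2)] show ?thesis
    by simp
qed

section \<open>Inflation factors below 2\<close>

theorem theorem1:
  fixes \<theta> :: real and \<Lambda> F :: "(real ^ 'n) set"
  assumes "1 < \<theta>" and "\<theta> < 2"
    and "uniform_discrete \<Lambda>"
    and "\<exists>x\<in>\<Lambda>. \<exists>y\<in>\<Lambda>. x \<noteq> y"
    and "finite F"
    and "\<Lambda> = (\<lambda>x. \<theta> *\<^sub>R x) ` \<Lambda> + F"
  shows "pisot_number \<theta>"
proof -
  obtain \<delta> where "0 < \<delta>" "\<And>p. p \<in> sign_polys \<Longrightarrow> ieval p \<theta> \<noteq> 0 \<Longrightarrow> \<delta> \<le> \<bar>ieval p \<theta>\<bar>"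
    using inflation_gap[OF assms(1,3,4,6)] by blast
  then interpret discrete_base \<theta> \<delta>
    using assms(1,2) by unfold_locales auto
  obtain p where p: "is_min_poly p \<theta>"
    using min_poly_exists[OF algebraic_integer_base] by blast
  have "cmod z < 1" if "poly (map_poly of_rat p) z = 0" "z \<noteq> of_real \<theta>" for z :: complex
  proof (rule ccontr)
    assume "\<not> cmod z < 1"
    then interpret conjugate_base \<theta> \<delta> z
      using min_poly_conjugate[OF p that(1)] by unfold_locales auto
    show False using no_other_large_conjugate that(2) by blast
  qed
  with p assms(1) algebraic_integer_base show ?thesis
    unfolding pisot_number_def by blast
qed

end
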